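(* For any $\beta\in\mathbb{Z}_+$, the envelope $\rho_\beta^{\rm slow}(s,k)$ belongs to the Hörmander class $S^{-\frac{\beta}{3}}_{\frac23,\frac13}([0,2P]\times(0,\infty))$. Moreover, given $k_0>1$ and $n\in\mathbb{Z}_+$, there is a constant $C>0$ (independent of $s$ and $k$) such that $$|D_s^n\rho_\beta^{\rm slow}(s,k)|\le C\,k^{-\frac{\beta}{3}}\,W(s,k)^{-n}$$ for all $(s,k)\in[0,2P]\times[k_0,\infty)$.
   Context: Notation: $\mathbb{Z}_+=\{0,1,2,\ldots\}$, $\mathbb{N}=\{1,2,\ldots\}$, $-\mathbb{N}=\{-1,-2,\ldots\}$, $t_-=\min\{t,0\}$; an empty sum is zero. Scattering problem. $K\subset\mathbb{R}^2$ is a compact, strictly convex obstacle with smooth boundary of length $2P$ and exterior unit normal $\nu$; $u^{\rm inc}(x)=e^{ik\alpha\cdot x}$ with $|\alpha|=1$, $k>0$; $u$ is the solution of $(\Delta+k^2)u=0$ in $\mathbb{R}^2\setminus K$, $\partial_\nu u=-\partial_\nu u^{\rm inc}$ on $\partial K$, $\lim_{r=|x|\to\infty}\sqrt r(\partial_r u-iku)=0$. The total field on $\partial K$ is $\eta=u+u^{\rm inc}$. $\gamma$ is the $2P$-periodic counterclockwise arc length parametrization of $\partial K$ for which $\alpha\cdot\nu(\gamma(s))$ vanishes on $[0,2P]$ exactly at $s=t_1,t_2$, with $0<t_1<t_2<2P$, $t_1+t_2=2P$, is negative on $(t_1,t_2)$ (illuminated region) and positive on $[0,t_1)\cup(t_2,2P]$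 (shadow region). Write $\eta(s,k)$ for $\eta$ at $\gamma(s)$ and $\eta^{\rm slow}(s,k)=e^{-ik\alpha\cdot\gamma(s)}\eta(s,k)$. Hörmander class: a $C^\infty$ function $a(s,k)$ on $[0,2P]\times(0,\infty)$ belongs to $S^{\mu}_{\varrho,\delta}([0,2P]\times(0,\infty))$ if for all $n,m\in\mathbb{Z}_+$ and every $k_0>0$ there is $C$ with $|D_s^nD_k^m a(s,k)|\le C k^{\mu+\delta n-\varrho m}$ for $s\in[0,2P]$, $k\ge k_0$. Asymptotic expansion (a known fact about $\eta^{\rm slow}$, which also provides the functions below). $\eta^{\rm slow}\in S^0_{\frac23,\frac13}([0,2P]\times(0,\infty))$ and $\eta^{\rm slow}\sim\sum_{p,q,r\in\mathbb{Z}_+,\,\ell\in-\mathbb{N}}a_{p,q,r,\ell}$ with $$a_{p,q,r,\ell}(s,k)=k^{-\frac{1+2p+3q+r+\ell}{3}+(\ell+1)_-}\,b_{p,q,r,\ell}(s)\,(\Psi^{r,\ell})^{(p)}(k^{\frac13}Z(s)),$$ where $b_{p,q,r,\ell}$ are $2P$-periodic complex-valued $C^\infty$ functions; $Z$ is a $2P$-periodic real-valued $C^\infty$ function, positive on the illuminated region, negative on the shadow region, vanishing precisely to first order at $t_1,t_2$; $\Psi^{r,\ell}$ are complex-valued $C^\infty$ functions on $\mathbb{R}$ with $\Psi^{r,\ell}(\tau)\sim\sum_{j\in\mathbb{Z}_+}a_{r,\ell,j}\tau^{1+\ell-2r-3j}$ as $\tau\to+\infty$ (in the sense of symbols, differentiable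 term by term) and rapidly decreasing with all derivatives as $\tau\to-\infty$. The relation $\sim$ means: for every $M>0$ there is a finite index set $F_M$ such that $\eta^{\rm slow}-\sum_{F}a_{p,q,r,\ell}\in S^{-M}_{\frac23,\frac13}([0,2P]\times(0,\infty))$ for every finite $F\supseteq F_M$. Definitions. $$\vartheta(p,q,r,\ell)=-\frac{1+2p+3q+r+\ell}{3}+(\ell+1)_-+\begin{cases}0, & 1+\ell-2r-p<0,\\ \frac{1+\ell-2r-p}{3}, & 1+\ell-2r-p\ge 0,\end{cases}$$ $\mathcal{F}_\beta=\{(p,q,r,\ell)\in\mathbb{Z}_+^3\times(-\mathbb{N}):\vartheta(p,q,r,\ell)>-\beta/3\}$, $\sigma_\beta^{\rm slow}=\sum_{(p,q,r,\ell)\in\mathcal{F}_\beta}a_{p,q,r,\ell}$, $\rho_\beta^{\rm slow}=\eta^{\rm slow}-\sigma_\beta^{\rm slow}$. Finally $W(s,k)=k^{-\frac13}+|\omega(s)|$ with $\omega(s)=(s-t_1)(t_2-s)$. *)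

theory Defs
  imports "HOL-Analysis.Analysis" "HOL-Library.Landau_Symbols"
begin

section \<open>Smooth functions and derivatives\<close>

text \<open>
  \<open>C\<^sup>n\<close> on a set, with derivatives taken relative to the set: on an open set this is the
  usual notion, and on a set such as \<open>[0, L] \<times> (0, \<infinity>)\<close>, which is the closure of its interior
  relative to the half plane \<open>k > 0\<close>, it means \<open>C\<^sup>n\<close> up to the boundary (one-sided derivatives).
\<close>

primrec Ck_on ::
  "nat \<Rightarrow> ('a::euclidean_space \<Rightarrow> 'b::real_normed_vector) \<Rightarrow> 'a set \<Rightarrow> bool" where
  "Ck_on 0 f S = continuous_on S f"
| "Ck_on (Suc n) f S =
    (\<exists>D. (\<forall>x\<in>S. (f has_derivative D x) (at x within S)) \<and>
         (\<forall>v\<in>Basis. Ck_on n (\<lambda>x. D x v) S))"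

definition smooth_on :: "('a::euclidean_space \<Rightarrow> 'b::real_normed_vector) \<Rightarrow> 'a set \<Rightarrow> bool" where
  "smooth_on f S \<longleftrightarrow> (\<forall>n. Ck_on n f S)"

definition nth_vderiv :: "nat \<Rightarrow> (real \<Rightarrow> 'b::real_normed_vector) \<Rightarrow> real \<Rightarrow> 'b" where
  "nth_vderiv n = (\<lambda>f t. vector_derivative f (at t)) ^^ n"

definition laplacian :: "('a::euclidean_space \<Rightarrow> complex) \<Rightarrow> 'a \<Rightarrow> complex" where
  "laplacian f x =
    (\<Sum>v\<in>Basis. frechet_derivative (\<lambda>y. frechet_derivative f (at y) v) (at x) v)"

definition periodic :: "real \<Rightarrow> (real \<Rightarrow> 'b) \<Rightarrow> bool" where
  "periodic T f \<longleftrightarrow> (\<forall>s. f (s + T) = f s)"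


section \<open>Hoermander symbol classes on \<open>[0, L] \<times> (0, \<infinity>)\<close>\<close>

text \<open>At the end points \<open>s = 0\<close> and \<open>s = L\<close> the derivative in \<open>s\<close> is one-sided.\<close>

definition D_s :: "real \<Rightarrow> (real \<Rightarrow> real \<Rightarrow> complex) \<Rightarrow> real \<Rightarrow> real \<Rightarrow> complex" where
  "D_s L f s k = vector_derivative (\<lambda>s'. f s' k) (at s within {0..L})"

definition D_k :: "(real \<Rightarrow> real \<Rightarrow> complex) \<Rightarrow> real \<Rightarrow> real \<Rightarrow> complex" where
  "D_k f s k = vector_derivative (\<lambda>k'. f s k') (at k)"

definition symbol_class ::
  "real \<Rightarrow> real \<Rightarrow> real \<Rightarrow> real \<Rightarrow> (real \<Rightarrow> real \<Rightarrow> complex) set" where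
  "symbol_class \<mu> \<rho> \<delta> L =
    {a. smooth_on (\<lambda>(s, k). a s k) ({0..L} \<times> {0<..}) \<and>
        (\<forall>n m. \<forall>k0>0. \<exists>C. \<forall>s\<in>{0..L}. \<forall>k\<ge>k0.
           norm ((D_s L ^^ n) ((D_k ^^ m) a) s k)
             \<le> C * k powr (\<mu> + \<delta> * real n - \<rho> * real m))}"


section \<open>The scattering problem\<close>

definition strictly_convex :: "'a::real_normed_vector set \<Rightarrow> bool" where
  "strictly_convex K \<longleftrightarrow>
    (\<forall>x\<in>K. \<forall>y\<in>K. x \<noteq> y \<longrightarrow> open_segment x y \<subseteq> interior K)"

text \<open>
  The boundary of \<open>K\<close> is a simple closed smooth curve of length \<open>2 P\<close>, parametrized by arc length
  by \<open>\<gamma>\<close>; \<open>\<nu>\<close> is the exterior unit normal on it. The parametrization is counterclockwise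
  iff the frame (exterior normal, tangent) is positively oriented, which is the last conjunct.
\<close>

definition convex_obstacle ::
  "(real^2) set \<Rightarrow> real \<Rightarrow> (real \<Rightarrow> real^2) \<Rightarrow> (real^2 \<Rightarrow> real^2) \<Rightarrow> bool" where
  "convex_obstacle K P \<gamma> \<nu> \<longleftrightarrow>
    compact K \<and> strictly_convex K \<and> P > 0 \<and>
    smooth_on \<gamma> UNIV \<and> periodic (2 * P) \<gamma> \<and> inj_on \<gamma> {0..<2 * P} \<and>
    \<gamma> ` {0..2 * P} = frontier K \<and>
    (\<forall>s. norm (vector_derivative \<gamma> (at s)) = 1) \<and>
    (\<forall>s. norm (\<nu> (\<gamma> s)) = 1 \<and> \<nu> (\<gamma> s) \<bullet> vector_derivative \<gamma> (at s) = 0 \<and>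
         (\<exists>\<epsilon>>0. \<forall>h. 0 < h \<and> h < \<epsilon> \<longrightarrow> \<gamma> s + h *\<^sub>R \<nu> (\<gamma> s) \<notin> K)) \<and>
    (\<forall>s. \<nu> (\<gamma> s) $ 1 * vector_derivative \<gamma> (at s) $ 2
         - \<nu> (\<gamma> s) $ 2 * vector_derivative \<gamma> (at s) $ 1 > 0)"

definition shadow_points ::
  "real \<Rightarrow> (real \<Rightarrow> real^2) \<Rightarrow> (real^2 \<Rightarrow> real^2) \<Rightarrow> real^2 \<Rightarrow> real \<Rightarrow> real \<Rightarrow> bool" where
  "shadow_points P \<gamma> \<nu> \<alpha> t1 t2 \<longleftrightarrow>
    0 < t1 \<and> t1 < t2 \<and> t2 < 2 * P \<and> t1 + t2 = 2 * P \<and>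
    {s \<in> {0..2 * P}. \<alpha> \<bullet> \<nu> (\<gamma> s) = 0} = {t1, t2} \<and>
    (\<forall>s\<in>{t1<..<t2}. \<alpha> \<bullet> \<nu> (\<gamma> s) < 0) \<and>
    (\<forall>s\<in>{0..<t1} \<union> {t2<..2 * P}. \<alpha> \<bullet> \<nu> (\<gamma> s) > 0)"

definition u_inc :: "real^2 \<Rightarrow> real \<Rightarrow> real^2 \<Rightarrow> complex" where
  "u_inc \<alpha> k x = exp (\<i> * of_real (k * (\<alpha> \<bullet> x)))"

text \<open>
  A classical solution of the sound-hard problem: twice continuously differentiable in the exterior
  and \<open>C\<^sup>1\<close> up to the boundary. The limit at infinity is uniform in all directions.
\<close>

definition scattered_field ::
  "(real^2) set \<Rightarrow> (real^2 \<Rightarrow> real^2) \<Rightarrow> real^2 \<Rightarrow> real \<Rightarrow> (real^2 \<Rightarrow> complex) \<Rightarrow> bool" where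
  "scattered_field K \<nu> \<alpha> k u \<longleftrightarrow>
    Ck_on 2 u (- K) \<and> Ck_on 1 u (closure (- K)) \<and>
    (\<forall>x\<in>- K. laplacian u x + (of_real k)\<^sup>2 * u x = 0) \<and>
    (\<forall>x\<in>frontier K.
       frechet_derivative u (at x within closure (- K)) (\<nu> x)
         = - frechet_derivative (u_inc \<alpha> k) (at x) (\<nu> x)) \<and>
    ((\<lambda>x. of_real (sqrt (norm x)) *
            (frechet_derivative u (at x) (x /\<^sub>R norm x) - \<i> * of_real k * u x))
       \<longlongrightarrow> 0) at_infinity"

text \<open>Here \<open>u k\<close> is the scattered field at frequency \<open>k\<close>.\<close>

definition eta ::
  "(real \<Rightarrow> real^2) \<Rightarrow> real^2 \<Rightarrow> (real \<Rightarrow> real^2 \<Rightarrow> complex) \<Rightarrow> real \<Rightarrow> real \<Rightarrow> complex" where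
  "eta \<gamma> \<alpha> u s k = u k (\<gamma> s) + u_inc \<alpha> k (\<gamma> s)"

definition eta_slow ::
  "(real \<Rightarrow> real^2) \<Rightarrow> real^2 \<Rightarrow> (real \<Rightarrow> real^2 \<Rightarrow> complex) \<Rightarrow> real \<Rightarrow> real \<Rightarrow> complex" where
  "eta_slow \<gamma> \<alpha> u s k = exp (- \<i> * of_real (k * (\<alpha> \<bullet> \<gamma> s))) * eta \<gamma> \<alpha> u s k"


section \<open>The asymptotic expansion of the slow envelope\<close>

type_synonym index = "nat \<times> nat \<times> nat \<times> int"

definition indices :: "index set" where
  "indices = {(p, q, r, l). l \<le> -1}"

definition neg_part :: "real \<Rightarrow> real" where
  "neg_part t = min t 0"

fun slow_term ::
  "(nat \<Rightarrow> nat \<Rightarrow> nat \<Rightarrow> int \<Rightarrow> real \<Rightarrow> complex) \<Rightarrow> (real \<Rightarrow> real) \<Rightarrow>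
   (nat \<Rightarrow> int \<Rightarrow> real \<Rightarrow> complex) \<Rightarrow> index \<Rightarrow> real \<Rightarrow> real \<Rightarrow> complex" where
  "slow_term b Z \<Psi> (p, q, r, l) s k =
    of_real (k powr (- (1 + 2 * real p + 3 * real q + real r + of_int l) / 3
                     + neg_part (of_int l + 1)))
    * b p q r l s * nth_vderiv p (\<Psi> r l) (k powr (1 / 3) * Z s)"

text \<open>
  \<open>f(\<tau>) \<sim> \<Sum>\<^sub>j c\<^sub>j \<tau>\<^bsup>m - 3 j\<^esup>\<close> as \<open>\<tau> \<rightarrow> \<infinity>\<close> in the sense of symbols: the
  remainder after \<open>N\<close> terms is of order \<open>m - 3 N\<close>, and each derivative lowers the order by one.
\<close>

definition symbol_expansion_at_top ::
  "(real \<Rightarrow> complex) \<Rightarrow> int \<Rightarrow> (nat \<Rightarrow> complex) \<Rightarrow> bool" where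
  "symbol_expansion_at_top f m c \<longleftrightarrow>
    (\<forall>N n. nth_vderiv n (\<lambda>\<tau>. f \<tau> - (\<Sum>j<N. c j * of_real (\<tau> powi (m - 3 * int j))))
             \<in> O[at_top](\<lambda>\<tau>. of_real (\<tau> powi (m - 3 * int N - int n))))"

definition rapidly_decreasing_at_bot :: "(real \<Rightarrow> complex) \<Rightarrow> bool" where
  "rapidly_decreasing_at_bot f \<longleftrightarrow>
    (\<forall>n N. nth_vderiv n f \<in> O[at_bot](\<lambda>\<tau>. of_real (\<tau> powi (- int N))))"

definition slow_expansion ::
  "real \<Rightarrow> real \<Rightarrow> real \<Rightarrow> (real \<Rightarrow> real \<Rightarrow> complex) \<Rightarrow>
   (nat \<Rightarrow> nat \<Rightarrow> nat \<Rightarrow> int \<Rightarrow> real \<Rightarrow> complex) \<Rightarrow> (real \<Rightarrow> real) \<Rightarrow>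
   (nat \<Rightarrow> int \<Rightarrow> real \<Rightarrow> complex) \<Rightarrow> (nat \<Rightarrow> int \<Rightarrow> nat \<Rightarrow> complex) \<Rightarrow> bool" where
  "slow_expansion P t1 t2 \<eta> b Z \<Psi> a \<longleftrightarrow>
    \<eta> \<in> symbol_class 0 (2/3) (1/3) (2 * P) \<and>
    (\<forall>p q r. \<forall>l\<le>-1. smooth_on (b p q r l) UNIV \<and> periodic (2 * P) (b p q r l)) \<and>
    smooth_on Z UNIV \<and> periodic (2 * P) Z \<and>
    (\<forall>s\<in>{t1<..<t2}. Z s > 0) \<and> (\<forall>s\<in>{0..<t1} \<union> {t2<..2 * P}. Z s < 0) \<and>
    (\<forall>t\<in>{t1, t2}. Z t = 0 \<and> vector_derivative Z (at t) \<noteq> 0) \<and>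
    (\<forall>r. \<forall>l\<le>-1. smooth_on (\<Psi> r l) UNIV \<and>
       symbol_expansion_at_top (\<Psi> r l) (1 + l - 2 * int r) (a r l) \<and>
       rapidly_decreasing_at_bot (\<Psi> r l)) \<and>
    (\<forall>M>0. \<exists>F\<^sub>M. finite F\<^sub>M \<and> F\<^sub>M \<subseteq> indices \<and>
       (\<forall>F. finite F \<and> F\<^sub>M \<subseteq> F \<and> F \<subseteq> indices \<longrightarrow>
          (\<lambda>s k. \<eta> s k - (\<Sum>i\<in>F. slow_term b Z \<Psi> i s k))
            \<in> symbol_class (- M) (2/3) (1/3) (2 * P)))"


section \<open>Truncations and remainders\<close>

fun vartheta :: "index \<Rightarrow> real" where
  "vartheta (p, q, r, l) =
    - (1 + 2 * real p + 3 * real q + real r + of_int l) / 3 + neg_part (of_int l + 1)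
    + (if 1 + l - 2 * int r - int p < 0 then 0 else of_int (1 + l - 2 * int r - int p) / 3)"

definition index_cut :: "nat \<Rightarrow> index set" where
  "index_cut \<beta> = {i \<in> indices. vartheta i > - real \<beta> / 3}"

text \<open>The sums over \<open>index_cut \<beta>\<close> below are genuine finite sums.\<close>

lemma finite_index_cut: "finite (index_cut \<beta>)"
proof (rule finite_subset)
  show "index_cut \<beta> \<subseteq> {..\<beta>} \<times> {..\<beta>} \<times> {..\<beta>} \<times> {- int \<beta> - 1..-1}"
  proof
    fix i assume i: "i \<in> index_cut \<beta>"
    obtain p q r l where i_eq: "i = (p, q, r, l)" by (cases i)
    have l: "l \<le> -1" using i by (simp add: i_eq index_cut_def indices_def)
    have "(if 1 + l - 2 * int r - int p < 0 then 0
           else of_int (1 + l - 2 * int r - int p) / 3 :: real) = 0"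
      using l by auto
    moreover have "neg_part (of_int l + 1) = of_int l + 1"
      using l by (simp add: neg_part_def)
    ultimately have
      "- (1 + 2 * real p + 3 * real q + real r + of_int l) / 3 + (of_int l + 1) > - real \<beta> / 3"
      using i by (simp add: i_eq index_cut_def)
    hence "of_int (2 * int p + 3 * int q + int r - 2 * l - 2) < (of_int (int \<beta>) :: real)"
      by (simp add: field_simps)
    hence "2 * int p + 3 * int q + int r - 2 * l - 2 < int \<beta>"
      by (simp only: of_int_less_iff)
    thus "i \<in> {..\<beta>} \<times> {..\<beta>} \<times> {..\<beta>} \<times> {- int \<beta> - 1..-1}"
      using l by (auto simp: i_eq)
  qed
qed auto

definition sigma_slow ::
  "nat \<Rightarrow> (nat \<Rightarrow> nat \<Rightarrow> nat \<Rightarrow> int \<Rightarrow> real \<Rightarrow> complex) \<Rightarrow> (real \<Rightarrow> real) \<Rightarrow>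
   (nat \<Rightarrow> int \<Rightarrow> real \<Rightarrow> complex) \<Rightarrow> real \<Rightarrow> real \<Rightarrow> complex" where
  "sigma_slow \<beta> b Z \<Psi> s k = (\<Sum>i\<in>index_cut \<beta>. slow_term b Z \<Psi> i s k)"

definition rho_slow ::
  "nat \<Rightarrow> (real \<Rightarrow> real \<Rightarrow> complex) \<Rightarrow> (nat \<Rightarrow> nat \<Rightarrow> nat \<Rightarrow> int \<Rightarrow> real \<Rightarrow> complex) \<Rightarrow>
   (real \<Rightarrow> real) \<Rightarrow> (nat \<Rightarrow> int \<Rightarrow> real \<Rightarrow> complex) \<Rightarrow> real \<Rightarrow> real \<Rightarrow> complex" where
  "rho_slow \<beta> \<eta> b Z \<Psi> s k = \<eta> s k - sigma_slow \<beta> b Z \<Psi> s k"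

definition omega :: "real \<Rightarrow> real \<Rightarrow> real \<Rightarrow> real" where
  "omega t1 t2 s = (s - t1) * (t2 - s)"

definition W :: "real \<Rightarrow> real \<Rightarrow> real \<Rightarrow> real \<Rightarrow> real" where
  "W t1 t2 s k = k powr (- 1 / 3) + \<bar>omega t1 t2 s\<bar>"

end

theory Submission
  imports Defs
begin

text \<open>
  Since only \<open>l \<le> -1\<close> occurs, the case distinction in \<open>vartheta\<close> always contributes zero, and
  \<open>vartheta i\<close> is exactly the exponent of \<open>k\<close> in the term with index \<open>i\<close>. That term thus reads
  \<open>k powr vartheta i * b s * \<Phi> (k powr (1/3) * Z s)\<close>. The profile \<open>\<Phi>\<close>, a derivative of
  \<open>\<Psi> r l\<close>, is a symbol of order zero on the line: on the right the leading exponent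
  \<open>1 + l - 2 r\<close> of \<open>\<Psi> r l\<close> is nonpositive, and on the left the decay is rapid.

  Functions of this shape survive differentiation. A derivative in \<open>k\<close> replaces \<open>\<Phi>\<close> by
  another symbol of the same order and lowers the exponent of \<open>k\<close> by one. A derivative in \<open>s\<close>
  falls on \<open>b\<close>, which costs nothing, or on \<open>\<Phi>\<close>, which produces a factor \<open>k powr (1/3)\<close> together
  with one more order of decay in \<open>\<tau> = k powr (1/3) * Z s\<close>; jointly these cost
  \<open>k powr (1/3) / (1 + \<bar>\<tau>\<bar>) = 1 / (k powr (-1/3) + \<bar>Z s\<bar>)\<close>, which is at most a constant times \<open>1 / W\<close>, because \<open>Z\<close> and \<open>\<omega>\<close> have the same simple zeros
  on \<open>[0, 2P]\<close>, so that \<open>\<bar>Z\<bar> \<ge> c \<bar>\<omega>\<bar>\<close> (\<open>simple_zeros_bound_below\<close>). The bookkeeping is done by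
  the predicate \<open>layer_sum Z e j\<close>; its members are \<open>O(k powr e / W ^ j)\<close> (\<open>layer_sum_bound\<close>), and
  \<open>n\<close> derivatives in \<open>s\<close> and \<open>m\<close> in \<open>k\<close> lead from \<open>(e, j)\<close> to \<open>(e - m, j + n)\<close>
  (\<open>layer_sum_mixed\<close>). As \<open>1 / W \<le> k powr (1/3)\<close>, the Hoermander estimates follow from this bound.

  For every \<open>M > 0\<close> the remainder \<open>\<rho>\<close> is an element of the class of order \<open>- M\<close> plus finitely
  many terms with \<open>vartheta i \<le> - \<beta> / 3\<close>. These terms satisfy both claims. The element of
  order \<open>- M\<close> satisfies them as soon as \<open>M\<close> is large: its \<open>n\<close>-th derivative in \<open>s\<close> loses
  \<open>k powr (n/3)\<close>, while \<open>W\<close> is bounded above, so \<open>M > \<beta>/3 + n/3\<close> is enough. Hence the number of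
  terms split off depends on \<open>n\<close>.
\<close>

section \<open>Smooth functions\<close>

lemma Ck_on_cong:
  assumes "\<And>x. x \<in> S \<Longrightarrow> f x = g x" and "Ck_on n f S"
  shows "Ck_on n g S"
proof (cases n)
  case 0
  thus ?thesis using assms by (simp cong: continuous_on_cong)
next
  case (Suc m)
  then obtain D where "\<forall>x\<in>S. (f has_derivative D x) (at x within S)"
      and "\<forall>v\<in>Basis. Ck_on m (\<lambda>x. D x v) S"
    using assms(2) by auto
  moreover from this(1) have "\<forall>x\<in>S. (g has_derivative D x) (at x within S)"
    by (metis assms(1) has_derivative_transform)
  ultimately show ?thesis using Suc by auto
qed

lemma Ck_on_SucD: "Ck_on (Suc n) f S \<Longrightarrow> Ck_on n f S"
proof (induction n arbitrary: f)
  case 0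
  thus ?case by (auto intro: has_derivative_continuous_on)
next
  case (Suc n)
  then obtain D where "\<forall>x\<in>S. (f has_derivative D x) (at x within S)"
      and "\<forall>v\<in>Basis. Ck_on (Suc n) (\<lambda>x. D x v) S"
    by (metis Ck_on.simps(2))
  thus ?case using Suc.IH by (metis Ck_on.simps(2))
qed

lemma Ck_on_add: "Ck_on n f S \<Longrightarrow> Ck_on n g S \<Longrightarrow> Ck_on n (\<lambda>x. f x + g x) S"
proof (induction n arbitrary: f g)
  case 0
  thus ?case by (auto intro: continuous_intros)
next
  case (Suc n)
  then obtain D E where
    D: "\<forall>x\<in>S. (f has_derivative D x) (at x within S)" "\<forall>v\<in>Basis. Ck_on n (\<lambda>x. D x v) S" and
    E: "\<forall>x\<in>S. (g has_derivative E x) (at x within S)" "\<forall>v\<in>Basis. Ck_on n (\<lambda>x. E x v) S"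
    by auto
  show ?case
    unfolding Ck_on.simps
    by (rule exI[of _ "\<lambda>x h. D x h + E x h"])
       (use D E Suc.IH in \<open>auto intro: derivative_intros\<close>)
qed

lemma Ck_on_scaleR:
  "Ck_on n f S \<Longrightarrow> Ck_on n g S \<Longrightarrow> Ck_on n (\<lambda>x. f x *\<^sub>R g x) S"
proof (induction n arbitrary: f g)
  case 0
  thus ?case by (auto intro: continuous_intros)
next
  case (Suc n)
  then obtain D E where
    D: "\<forall>x\<in>S. (f has_derivative D x) (at x within S)" "\<forall>v\<in>Basis. Ck_on n (\<lambda>x. D x v) S" and
    E: "\<forall>x\<in>S. (g has_derivative E x) (at x within S)" "\<forall>v\<in>Basis. Ck_on n (\<lambda>x. E x v) S"
    by auto
  have "Ck_on n f S" "Ck_on n g S"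
    using Suc.prems by (auto simp del: Ck_on.simps intro: Ck_on_SucD)
  thus ?case
    unfolding Ck_on.simps
    by (intro exI[of _ "\<lambda>x h. f x *\<^sub>R E x h + D x h *\<^sub>R g x"])
       (use D E Suc.IH in \<open>auto intro!: derivative_intros Ck_on_add\<close>)
qed

lemma smooth_on_add: "smooth_on f S \<Longrightarrow> smooth_on g S \<Longrightarrow> smooth_on (\<lambda>x. f x + g x) S"
  by (simp add: smooth_on_def Ck_on_add)

lemma smooth_on_scaleR:
  "smooth_on f S \<Longrightarrow> smooth_on g S \<Longrightarrow> smooth_on (\<lambda>x. f x *\<^sub>R g x) S"
  by (simp add: smooth_on_def Ck_on_scaleR)

lemma smooth_on_imp_continuous_on: "smooth_on f S \<Longrightarrow> continuous_on S f"
  unfolding smooth_on_def by (metis Ck_on.simps(1))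

text \<open>
  Smoothness is the greatest property that passes from a function to its partial derivatives, so
  any family of differentiable functions that contains its own partial derivatives consists of
  smooth functions. Closure of a family under differentiation, which the estimates rest on anyway,
  thus yields smoothness as well.
\<close>

lemma smooth_on_coinduct:
  assumes "X f"
    and step: "\<And>f. X f \<Longrightarrow> \<exists>D. (\<forall>x\<in>S. (f has_derivative D x) (at x within S)) \<and>
                            (\<forall>v\<in>Basis. X (\<lambda>x. D x v))"
  shows "smooth_on f S"
proof -
  have "Ck_on n f S" if "X f" for n f
    using that
  proof (induction n arbitrary: f)
    case 0
    thus ?case using step has_derivative_continuous_on by (metis Ck_on.simps(1))
  next
    case (Suc n)
    thus ?case using step[of f] by auto
  qed
  thus ?thesis using assms(1) by (simp add: smooth_on_def)
qed

lemma smooth_on_real_derivative: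
  fixes f :: "real \<Rightarrow> 'b::real_normed_vector"
  assumes "smooth_on f UNIV"
  shows "(f has_vector_derivative vector_derivative f (at t)) (at t)"
    and "smooth_on (\<lambda>t. vector_derivative f (at t)) UNIV"
proof -
  have *: "\<exists>D. (\<forall>t. (f has_vector_derivative D t) (at t)) \<and> Ck_on n D UNIV" for n
  proof -
    have "Ck_on (Suc n) f UNIV" using assms smooth_on_def by blast
    then obtain D where D: "\<And>x. (f has_derivative D x) (at x)" "Ck_on n (\<lambda>x. D x 1) UNIV"
      by auto
    have "(f has_vector_derivative D x 1) (at x)" for x
    proof -
      have "D x h = h *\<^sub>R D x 1" for h
        using linear_scale[OF has_derivative_linear[OF D(1)], of x h 1] by simp
      thus ?thesis using D(1)[of x] has_vector_derivative_def by (metis ext)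
    qed
    thus ?thesis using D(2) by (intro exI[of _ "\<lambda>x. D x 1"]) simp
  qed
  show "(f has_vector_derivative vector_derivative f (at t)) (at t)"
    using *[of 0] by (metis vector_derivative_at)
  show "smooth_on (\<lambda>t. vector_derivative f (at t)) UNIV"
    unfolding smooth_on_def
  proof
    fix n
    obtain D where "\<forall>t. (f has_vector_derivative D t) (at t)" "Ck_on n D UNIV"
      using * by blast
    moreover from this(1) have "(\<lambda>t. vector_derivative f (at t)) = D"
      by (auto simp: vector_derivative_at)
    ultimately show "Ck_on n (\<lambda>t. vector_derivative f (at t)) UNIV" by simp
  qed
qed

lemma nth_vderiv_0 [simp]: "nth_vderiv 0 f = f"
  by (simp add: nth_vderiv_def)

lemma nth_vderiv_Suc: "nth_vderiv (Suc n) f = (\<lambda>t. vector_derivative (nth_vderiv n f) (at t))"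
  by (simp add: nth_vderiv_def)

lemma nth_vderiv_add: "nth_vderiv n (nth_vderiv m f) = nth_vderiv (n + m) f"
  by (simp add: nth_vderiv_def funpow_add)

lemma nth_vderiv_Suc': "nth_vderiv (Suc n) f = nth_vderiv n (\<lambda>t. vector_derivative f (at t))"
  unfolding nth_vderiv_def by (metis (no_types, lifting) comp_apply funpow_Suc_right)

lemma smooth_on_nth_vderiv: "smooth_on f UNIV \<Longrightarrow> smooth_on (nth_vderiv n f) UNIV"
  by (induction n) (auto simp: nth_vderiv_Suc smooth_on_real_derivative(2))


section \<open>Partial derivatives on the strip\<close>

abbreviation strip :: "real \<Rightarrow> (real \<times> real) set" where
  "strip L \<equiv> {0..L} \<times> {0<..}"

abbreviation strip_smooth :: "real \<Rightarrow> (real \<Rightarrow> real \<Rightarrow> complex) \<Rightarrow> bool" where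
  "strip_smooth L f \<equiv> smooth_on (\<lambda>(s, k). f s k) (strip L)"

text \<open>
  Smoothness on the strip is stated through Frechet derivatives, symbol classes through iterated
  partial derivatives. Restricting a Frechet derivative to the two coordinate lines through a point
  connects them; \<open>L > 0\<close> makes the one-sided derivatives at \<open>0\<close> and \<open>L\<close> unique.
\<close>

lemma partial_derivatives:
  assumes "L > 0" and s: "s \<in> {0..L}" and k: "k > 0"
    and D: "((\<lambda>(s, k). f s k) has_derivative D) (at (s, k) within strip L)"
  shows "((\<lambda>s. f s k) has_vector_derivative D (1, 0)) (at s within {0..L})"
    and "((\<lambda>k. f s k) has_vector_derivative D (0, 1)) (at k)"
    and "D_s L f s k = D (1, 0)" and "D_k f s k = D (0, 1)"
proof -
  have lin: "linear D" using D has_derivative_linear by blast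
  have "((\<lambda>s'. (s', k)) has_derivative (\<lambda>h. (h, 0))) (at s within {0..L})"
    by (auto intro!: derivative_eq_intros)
  moreover have "((\<lambda>(s, k). f s k) has_derivative D) (at (s, k) within ((\<lambda>s'. (s', k)) ` {0..L}))"
    by (rule has_derivative_subset[OF D]) (use k in auto)
  ultimately have "((\<lambda>s'. f s' k) has_derivative (\<lambda>h. D (h, 0))) (at s within {0..L})"
    using has_derivative_in_compose by fastforce
  moreover have "(\<lambda>h. D (h, 0)) = (\<lambda>h. h *\<^sub>R D (1, 0))"
  proof
    fix h show "D (h, 0) = h *\<^sub>R D (1, 0)"
      using linear_scale[OF lin, of h "(1, 0)"] by simp
  qed
  ultimately show 1: "((\<lambda>s. f s k) has_vector_derivative D (1, 0)) (at s within {0..L})"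
    unfolding has_vector_derivative_def by metis
  have "((\<lambda>k'. (s, k')) has_derivative (\<lambda>h. (0, h))) (at k within {0<..})"
    by (auto intro!: derivative_eq_intros)
  moreover have "((\<lambda>(s, k). f s k) has_derivative D) (at (s, k) within ((\<lambda>k'. (s, k')) ` {0<..}))"
    by (rule has_derivative_subset[OF D]) (use s in auto)
  ultimately have "((\<lambda>k'. f s k') has_derivative (\<lambda>h. D (0, h))) (at k within {0<..})"
    using has_derivative_in_compose by fastforce
  hence "((\<lambda>k'. f s k') has_derivative (\<lambda>h. D (0, h))) (at k)"
    using k by (metis at_within_open greaterThan_iff open_greaterThan)
  moreover have "(\<lambda>h. D (0, h)) = (\<lambda>h. h *\<^sub>R D (0, 1))"
  proof
    fix h show "D (0, h) = h *\<^sub>R D (0, 1)"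
      using linear_scale[OF lin, of h "(0, 1)"] by simp
  qed
  ultimately show 2: "((\<lambda>k. f s k) has_vector_derivative D (0, 1)) (at k)"
    unfolding has_vector_derivative_def by metis
  show "D_s L f s k = D (1, 0)"
    unfolding D_s_def using 1 assms(1) s vector_derivative_within_cbox[of 0 L s] by auto
  show "D_k f s k = D (0, 1)"
    unfolding D_k_def using 2 by (simp add: vector_derivative_at)
qed

lemma strip_smooth_partial_derivatives:
  assumes "L > 0" and f: "strip_smooth L f"
  shows "\<And>s k. s \<in> {0..L} \<Longrightarrow> k > 0 \<Longrightarrow>
            ((\<lambda>s. f s k) has_vector_derivative D_s L f s k) (at s within {0..L})"
    and "\<And>s k. s \<in> {0..L} \<Longrightarrow> k > 0 \<Longrightarrow> ((\<lambda>k. f s k) has_vector_derivative D_k f s k) (at k)"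
    and "strip_smooth L (D_s L f)" and "strip_smooth L (D_k f)"
proof -
  have "\<exists>D. (\<forall>x\<in>strip L. ((\<lambda>(s, k). f s k) has_derivative D x) (at x within strip L)) \<and>
            Ck_on n (\<lambda>x. D x (1, 0)) (strip L) \<and> Ck_on n (\<lambda>x. D x (0, 1)) (strip L)" for n
  proof -
    have "Ck_on (Suc n) (\<lambda>(s, k). f s k) (strip L)" using f smooth_on_def by blast
    thus ?thesis by (auto simp: Basis_prod_def)
  qed
  then obtain D where
    D: "\<And>n x. x \<in> strip L \<Longrightarrow> ((\<lambda>(s, k). f s k) has_derivative D n x) (at x within strip L)" and
    Ck: "\<And>n. Ck_on n (\<lambda>x. D n x (1, 0)) (strip L)" "\<And>n. Ck_on n (\<lambda>x. D n x (0, 1)) (strip L)"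
    by metis
  note partial = partial_derivatives[OF assms(1) _ _ D]
  show "((\<lambda>s. f s k) has_vector_derivative D_s L f s k) (at s within {0..L})"
    if "s \<in> {0..L}" "k > 0" for s k
    using partial(1,3)[OF that] that by auto
  show "((\<lambda>k. f s k) has_vector_derivative D_k f s k) (at k)"
    if "s \<in> {0..L}" "k > 0" for s k
    using partial(2,4)[OF that] that by auto
  have "Ck_on n (\<lambda>(s, k). D_s L f s k) (strip L)" for n
    by (rule Ck_on_cong[OF _ Ck(1)[of n]]) (use partial(3) in auto)
  thus "strip_smooth L (D_s L f)" by (simp add: smooth_on_def)
  have "Ck_on n (\<lambda>(s, k). D_k f s k) (strip L)" for n
    by (rule Ck_on_cong[OF _ Ck(2)[of n]]) (use partial(4) in auto)
  thus "strip_smooth L (D_k f)" by (simp add: smooth_on_def)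
qed

text \<open>
  Off the strip nothing is known about the functions, so iterated derivatives can only be computed
  from equalities that hold on the strip.
\<close>

lemma D_s_cong:
  assumes "\<And>s k. s \<in> {0..L} \<Longrightarrow> k > 0 \<Longrightarrow> f s k = g s k" and "s \<in> {0..L}" "k > 0"
  shows "D_s L f s k = D_s L g s k"
  unfolding D_s_def using assms
  by (intro vector_derivative_cong_eq) (auto simp: eventually_at_filter intro!: always_eventually)

lemma D_k_cong:
  assumes "\<And>s k. s \<in> {0..L} \<Longrightarrow> k > 0 \<Longrightarrow> f s k = g s k" and "s \<in> {0..L}" "k > 0"
  shows "D_k f s k = D_k g s k"
proof -
  have "eventually (\<lambda>k'. k' \<in> {0<..}) (nhds k)"
    using assms(3) by (intro eventually_nhds_in_open) auto
  hence "eventually (\<lambda>k'. f s k' = g s k') (nhds k)"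
    by eventually_elim (use assms in auto)
  thus ?thesis unfolding D_k_def using assms by (intro vector_derivative_cong_eq) auto
qed

abbreviation mixed :: "real \<Rightarrow> nat \<Rightarrow> nat \<Rightarrow> (real \<Rightarrow> real \<Rightarrow> complex) \<Rightarrow> real \<Rightarrow> real \<Rightarrow> complex" where
  "mixed L n m f \<equiv> (D_s L ^^ n) ((D_k ^^ m) f)"

lemma strip_smooth_add:
  "strip_smooth L f \<Longrightarrow> strip_smooth L g \<Longrightarrow> strip_smooth L (\<lambda>s k. f s k + g s k)"
  using smooth_on_add[of "\<lambda>(s, k). f s k" "strip L" "\<lambda>(s, k). g s k"]
  by (simp add: case_prod_unfold)

lemma strip_smooth_funpow_D_k: "L > 0 \<Longrightarrow> strip_smooth L f \<Longrightarrow> strip_smooth L ((D_k ^^ m) f)"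
  by (induction m) (auto intro: strip_smooth_partial_derivatives(4))

lemma strip_smooth_mixed: "L > 0 \<Longrightarrow> strip_smooth L f \<Longrightarrow> strip_smooth L (mixed L n m f)"
  by (induction n) (auto intro: strip_smooth_partial_derivatives(3) strip_smooth_funpow_D_k)

lemma D_s_add:
  assumes "L > 0" "strip_smooth L f" "strip_smooth L g" "s \<in> {0..L}" "k > 0"
  shows "D_s L (\<lambda>s k. f s k + g s k) s k = D_s L f s k + D_s L g s k"
proof -
  have "((\<lambda>s. f s k + g s k) has_vector_derivative D_s L f s k + D_s L g s k)
          (at s within {0..L})"
    using assms by (intro has_vector_derivative_add strip_smooth_partial_derivatives(1))
  thus ?thesis
    unfolding D_s_def[of L "\<lambda>s k. f s k + g s k"]
    using vector_derivative_within_cbox[of 0 L s] assms by auto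
qed

lemma D_k_add:
  assumes "L > 0" "strip_smooth L f" "strip_smooth L g" "s \<in> {0..L}" "k > 0"
  shows "D_k (\<lambda>s k. f s k + g s k) s k = D_k f s k + D_k g s k"
proof -
  have "((\<lambda>k. f s k + g s k) has_vector_derivative D_k f s k + D_k g s k) (at k)"
    using assms by (intro has_vector_derivative_add strip_smooth_partial_derivatives(2)) auto
  thus ?thesis
    unfolding D_k_def[of "\<lambda>s k. f s k + g s k"] by (rule vector_derivative_at)
qed

lemma mixed_add:
  assumes "L > 0" "strip_smooth L f" "strip_smooth L g" "s \<in> {0..L}" "k > 0"
  shows "mixed L n m (\<lambda>s k. f s k + g s k) s k = mixed L n m f s k + mixed L n m g s k"
proof -
  have 1: "(D_k ^^ m) (\<lambda>s k. f s k + g s k) s k = (D_k ^^ m) f s k + (D_k ^^ m) g s k"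
    if "s \<in> {0..L}" "k > 0" for s k
    using that
  proof (induction m arbitrary: s k)
    case (Suc m)
    show ?case
      using D_k_cong[OF Suc.IH Suc.prems]
        D_k_add[OF assms(1) strip_smooth_funpow_D_k strip_smooth_funpow_D_k Suc.prems] assms
      by auto
  qed simp
  show ?thesis
    using assms(4,5)
  proof (induction n arbitrary: s k)
    case 0
    thus ?case using 1 by simp
  next
    case (Suc n)
    show ?case
      using D_s_cong[OF Suc.IH Suc.prems]
        D_s_add[OF assms(1) strip_smooth_mixed strip_smooth_mixed Suc.prems] assms
      by auto
  qed
qed

text \<open>
  Both conclusions of the theorem bound mixed derivatives on a half strip, only the
  weight \<open>w\<close> differs.
\<close>

definition mixed_bounded ::
  "real \<Rightarrow> nat \<Rightarrow> nat \<Rightarrow> real \<Rightarrow> (real \<Rightarrow> real \<Rightarrow> real) \<Rightarrow> (real \<Rightarrow> real \<Rightarrow> complex) \<Rightarrow> bool" where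
  "mixed_bounded L n m k0 w f \<longleftrightarrow>
    (\<exists>C. \<forall>s\<in>{0..L}. \<forall>k\<ge>k0. norm (mixed L n m f s k) \<le> C * w s k)"

lemma mixed_bounded_add:
  assumes "L > 0" "k0 > 0" "strip_smooth L f" "strip_smooth L g"
    and "mixed_bounded L n m k0 w f" "mixed_bounded L n m k0 w g"
  shows "mixed_bounded L n m k0 w (\<lambda>s k. f s k + g s k)"
proof -
  obtain C C' where
    C: "\<forall>s\<in>{0..L}. \<forall>k\<ge>k0. norm (mixed L n m f s k) \<le> C * w s k"
       "\<forall>s\<in>{0..L}. \<forall>k\<ge>k0. norm (mixed L n m g s k) \<le> C' * w s k"
    using assms(5,6) unfolding mixed_bounded_def by blast
  show ?thesis
    unfolding mixed_bounded_def
  proof (intro exI[of _ "C + C'"] ballI allI impI)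
    fix s k assume sk: "s \<in> {0..L}" "k0 \<le> k"
    hence "norm (mixed L n m (\<lambda>s k. f s k + g s k) s k)
             \<le> norm (mixed L n m f s k) + norm (mixed L n m g s k)"
      using mixed_add[OF assms(1,3,4)] assms(2) norm_triangle_ineq by simp
    also have "\<dots> \<le> (C + C') * w s k"
      using C sk by (simp add: distrib_right add_mono)
    finally show "norm (mixed L n m (\<lambda>s k. f s k + g s k) s k) \<le> (C + C') * w s k" .
  qed
qed

lemma mixed_bounded_mono:
  assumes "mixed_bounded L n m k0 w f"
    and "\<And>s k. s \<in> {0..L} \<Longrightarrow> k \<ge> k0 \<Longrightarrow> 0 \<le> w s k \<and> w s k \<le> B * w' s k"
  shows "mixed_bounded L n m k0 w' f"
proof -
  obtain C where C: "\<forall>s\<in>{0..L}. \<forall>k\<ge>k0. norm (mixed L n m f s k) \<le> C * w s k"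
    using assms(1) unfolding mixed_bounded_def by blast
  show ?thesis
    unfolding mixed_bounded_def
  proof (intro exI[of _ "\<bar>C\<bar> * B"] ballI allI impI)
    fix s k assume sk: "s \<in> {0..L}" "k0 \<le> k"
    have "norm (mixed L n m f s k) \<le> C * w s k" using C sk by blast
    also have "\<dots> \<le> \<bar>C\<bar> * w s k" using assms(2)[OF sk] by (simp add: mult_right_mono)
    also have "\<dots> \<le> \<bar>C\<bar> * (B * w' s k)" using assms(2)[OF sk] by (simp add: mult_left_mono)
    finally show "norm (mixed L n m f s k) \<le> \<bar>C\<bar> * B * w' s k" by (simp add: mult.assoc)
  qed
qed

text \<open>
  The finite sum is added to a given \<open>f\<close> because that is the shape of the remainder, and the empty
  sum is then no special case.
\<close>

lemma strip_smooth_add_sum: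
  assumes "finite I" "strip_smooth L f" "\<And>i. i \<in> I \<Longrightarrow> strip_smooth L (g i)"
  shows "strip_smooth L (\<lambda>s k. f s k + (\<Sum>i\<in>I. g i s k))"
  using assms(1,3)
proof (induction I rule: finite_induct)
  case empty
  thus ?case using assms(2) by simp
next
  case (insert i I)
  have "strip_smooth L (\<lambda>s k. g i s k + (f s k + (\<Sum>i\<in>I. g i s k)))"
    by (rule strip_smooth_add) (use insert in auto)
  thus ?case using insert by (simp add: algebra_simps)
qed

lemma mixed_bounded_add_sum:
  assumes "L > 0" "k0 > 0" "finite I" "strip_smooth L f" "\<And>i. i \<in> I \<Longrightarrow> strip_smooth L (g i)"
    and "mixed_bounded L n m k0 w f" "\<And>i. i \<in> I \<Longrightarrow> mixed_bounded L n m k0 w (g i)"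
  shows "mixed_bounded L n m k0 w (\<lambda>s k. f s k + (\<Sum>i\<in>I. g i s k))"
  using assms(3,5,7)
proof (induction I rule: finite_induct)
  case empty
  thus ?case using assms(6) by simp
next
  case (insert i I)
  have "mixed_bounded L n m k0 w (\<lambda>s k. g i s k + (f s k + (\<Sum>i\<in>I. g i s k)))"
    by (rule mixed_bounded_add[OF assms(1,2)], rule_tac [2] strip_smooth_add_sum)
       (use insert assms(4) in auto)
  thus ?case using insert by (simp add: algebra_simps)
qed


section \<open>Symbols on the line\<close>

text \<open>The symbols of order \<open>- j\<close> on the whole line.\<close>

definition decaying_symbol :: "nat \<Rightarrow> (real \<Rightarrow> complex) \<Rightarrow> bool" where
  "decaying_symbol j \<Phi> \<longleftrightarrow> smooth_on \<Phi> UNIV \<and>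
    (\<forall>n. \<exists>C. \<forall>\<tau>. norm (nth_vderiv n \<Phi> \<tau>) * (1 + \<bar>\<tau>\<bar>) ^ (n + j) \<le> C)"

lemma decaying_symbol_derivative:
  "decaying_symbol j \<Phi> \<Longrightarrow> decaying_symbol (Suc j) (\<lambda>\<tau>. vector_derivative \<Phi> (at \<tau>))"
  unfolding decaying_symbol_def nth_vderiv_Suc'[symmetric]
  using smooth_on_real_derivative(2) by (metis add_Suc_shift)

text \<open>
  The action of \<open>k d/dk\<close> on profiles: the derivative of \<open>k powr c * \<Phi> (k powr (1/3) * z)\<close> with respect
  to \<open>k\<close> is \<open>k powr (c - 1) * euler_operator c \<Phi> (k powr (1/3) * z)\<close>.
\<close>

definition euler_operator :: "real \<Rightarrow> (real \<Rightarrow> complex) \<Rightarrow> real \<Rightarrow> complex" where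
  "euler_operator c \<Phi> \<tau> = c *\<^sub>R \<Phi> \<tau> + (\<tau> / 3) *\<^sub>R vector_derivative \<Phi> (at \<tau>)"

text \<open>
  Differentiating \<open>\<tau> / 3\<close> shifts the parameter by \<open>1 / 3\<close>, so the family of Euler operators
  commutes with differentiation up to this shift. This gives the smoothness of the image and a
  closed form of all its derivatives.
\<close>

lemma euler_operator_derivative:
  assumes "smooth_on \<Phi> UNIV"
  shows "(euler_operator c \<Phi> has_vector_derivative
            euler_operator (c + 1 / 3) (\<lambda>\<tau>. vector_derivative \<Phi> (at \<tau>)) \<tau>) (at \<tau>)"
proof -
  let ?\<Phi>' = "\<lambda>\<tau>. vector_derivative \<Phi> (at \<tau>)"
  have 1: "(\<Phi> has_vector_derivative ?\<Phi>' \<tau>) (at \<tau>)"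
    using assms by (rule smooth_on_real_derivative(1))
  have 2: "(?\<Phi>' has_vector_derivative vector_derivative ?\<Phi>' (at \<tau>)) (at \<tau>)"
    using assms by (intro smooth_on_real_derivative)
  have 3: "((\<lambda>\<tau>::real. \<tau> / 3) has_real_derivative 1 / 3) (at \<tau>)"
    by (auto intro!: derivative_eq_intros)
  have "((\<lambda>\<tau>. c *\<^sub>R \<Phi> \<tau> + (\<tau> / 3) *\<^sub>R ?\<Phi>' \<tau>) has_vector_derivative
          c *\<^sub>R ?\<Phi>' \<tau> + ((\<tau> / 3) *\<^sub>R vector_derivative ?\<Phi>' (at \<tau>) + (1 / 3) *\<^sub>R ?\<Phi>' \<tau>)) (at \<tau>)"
    by (intro has_vector_derivative_add has_vector_derivative_scaleR 1 2 3
          bounded_linear.has_vector_derivative[OF bounded_linear_scaleR_right])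
  thus ?thesis
    unfolding euler_operator_def [abs_def] by (simp add: algebra_simps)
qed

lemma smooth_on_euler_operator:
  assumes "smooth_on \<Phi> UNIV"
  shows "smooth_on (euler_operator c \<Phi>) UNIV"
proof (rule smooth_on_coinduct[where X = "\<lambda>f. \<exists>c \<Phi>. smooth_on \<Phi> UNIV \<and> f = euler_operator c \<Phi>"])
  fix f :: "real \<Rightarrow> complex" assume "\<exists>c \<Phi>. smooth_on \<Phi> UNIV \<and> f = euler_operator c \<Phi>"
  then obtain c \<Phi> where f: "smooth_on \<Phi> UNIV" "f = euler_operator c \<Phi>" by blast
  let ?f' = "euler_operator (c + 1 / 3) (\<lambda>\<tau>. vector_derivative \<Phi> (at \<tau>))"
  have "\<exists>c \<Phi>. smooth_on \<Phi> UNIV \<and> ?f' = euler_operator c \<Phi>"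
    using smooth_on_real_derivative(2)[OF f(1)] by blast
  thus "\<exists>D. (\<forall>x\<in>UNIV. (f has_derivative D x) (at x)) \<and>
            (\<forall>v\<in>Basis. \<exists>c \<Phi>. smooth_on \<Phi> UNIV \<and> (\<lambda>x. D x v) = euler_operator c \<Phi>)"
    using euler_operator_derivative[OF f(1)] f(2)
    by (intro exI[of _ "\<lambda>x h. h *\<^sub>R ?f' x"]) (auto simp: has_vector_derivative_def)
qed (use assms in blast)

lemma nth_vderiv_euler_operator:
  assumes "smooth_on \<Phi> UNIV"
  shows "nth_vderiv n (euler_operator c \<Phi>) = euler_operator (c + real n / 3) (nth_vderiv n \<Phi>)"
proof (induction n)
  case (Suc n)
  show ?case
    using vector_derivative_at[OF euler_operator_derivative[OF smooth_on_nth_vderiv[OF assms]]]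
    by (simp add: nth_vderiv_Suc Suc.IH fun_eq_iff add_divide_distrib algebra_simps)
qed simp

text \<open>The factor \<open>\<tau>\<close> is paid for by the additional decay of the derivative next to it.\<close>

lemma decaying_symbol_euler_operator:
  assumes "decaying_symbol j \<Phi>"
  shows "decaying_symbol j (euler_operator c \<Phi>)"
  unfolding decaying_symbol_def
proof (intro conjI allI)
  have \<Phi>: "smooth_on \<Phi> UNIV" using assms decaying_symbol_def by blast
  thus "smooth_on (euler_operator c \<Phi>) UNIV" by (rule smooth_on_euler_operator)
  fix n
  obtain C D where
    C: "\<And>\<tau>. norm (nth_vderiv n \<Phi> \<tau>) * (1 + \<bar>\<tau>\<bar>) ^ (n + j) \<le> C" and
    D: "\<And>\<tau>. norm (nth_vderiv (Suc n) \<Phi> \<tau>) * (1 + \<bar>\<tau>\<bar>) ^ (Suc n + j) \<le> D"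
    using assms unfolding decaying_symbol_def by meson
  define c' where "c' = \<bar>c + real n / 3\<bar>"
  show "\<exists>C. \<forall>\<tau>. norm (nth_vderiv n (euler_operator c \<Phi>) \<tau>) * (1 + \<bar>\<tau>\<bar>) ^ (n + j) \<le> C"
  proof (intro exI allI)
    fix \<tau> :: real
    let ?w = "(1 + \<bar>\<tau>\<bar>) ^ (n + j)" and ?d = "norm (nth_vderiv (Suc n) \<Phi> \<tau>)"
    have "norm (nth_vderiv n (euler_operator c \<Phi>) \<tau>) \<le> c' * norm (nth_vderiv n \<Phi> \<tau>) + \<bar>\<tau>\<bar> / 3 * ?d"
      unfolding nth_vderiv_euler_operator[OF \<Phi>] euler_operator_def nth_vderiv_Suc c'_def
      by (rule order_trans[OF norm_triangle_ineq]) simp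
    hence "norm (nth_vderiv n (euler_operator c \<Phi>) \<tau>) * ?w
             \<le> (c' * norm (nth_vderiv n \<Phi> \<tau>) + \<bar>\<tau>\<bar> / 3 * ?d) * ?w"
      by (rule mult_right_mono) simp
    also have "\<dots> = c' * (norm (nth_vderiv n \<Phi> \<tau>) * ?w) + ?d * (\<bar>\<tau>\<bar> / 3 * ?w)"
      by (simp add: algebra_simps)
    also have "\<dots> \<le> c' * C + ?d * (1 + \<bar>\<tau>\<bar>) ^ (Suc n + j)"
    proof (rule add_mono)
      show "c' * (norm (nth_vderiv n \<Phi> \<tau>) * ?w) \<le> c' * C"
        using C by (intro mult_left_mono) (auto simp: c'_def)
      have "\<bar>\<tau>\<bar> / 3 * ?w \<le> (1 + \<bar>\<tau>\<bar>) * ?w" by (intro mult_right_mono) auto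
      thus "?d * (\<bar>\<tau>\<bar> / 3 * ?w) \<le> ?d * (1 + \<bar>\<tau>\<bar>) ^ (Suc n + j)"
        by (intro mult_left_mono) auto
    qed
    also have "\<dots> \<le> c' * C + D" using D by simp
    finally show "norm (nth_vderiv n (euler_operator c \<Phi>) \<tau>) * ?w \<le> c' * C + D" .
  qed
qed

text \<open>
  The leading order of the expansion (no subtracted terms) bounds the derivatives for large
  \<open>\<tau>\<close>, rapid decrease bounds them for very negative \<open>\<tau>\<close>, and continuity on the compact interval
  in between.
\<close>

lemma decaying_symbol_nth_vderiv:
  fixes \<Psi> :: "real \<Rightarrow> complex"
  assumes smooth: "smooth_on \<Psi> UNIV" and "m \<le> 0"
    and top: "symbol_expansion_at_top \<Psi> m c" and bot: "rapidly_decreasing_at_bot \<Psi>"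
  shows "decaying_symbol 0 (nth_vderiv p \<Psi>)"
  unfolding decaying_symbol_def
proof (intro conjI allI)
  show "smooth_on (nth_vderiv p \<Psi>) UNIV" using smooth by (rule smooth_on_nth_vderiv)
  fix n
  let ?f = "nth_vderiv (n + p) \<Psi>"
  have "?f \<in> O[at_top](\<lambda>\<tau>. of_real (\<tau> powi (m - int (n + p))))"
    using top[unfolded symbol_expansion_at_top_def, rule_format, of "n + p" 0] by simp
  then obtain C1 where
    C1: "eventually (\<lambda>\<tau>. norm (?f \<tau>) \<le> C1 * norm (of_real (\<tau> powi (m - int (n + p))) :: complex)) at_top"
    by (elim landau_o.bigE)
  have "?f \<in> O[at_bot](\<lambda>\<tau>. of_real (\<tau> powi (- int n)))"
    using bot unfolding rapidly_decreasing_at_bot_def by blast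
  then obtain C2 where
    C2: "eventually (\<lambda>\<tau>. norm (?f \<tau>) \<le> C2 * norm (of_real (\<tau> powi (- int n)) :: complex)) at_bot"
    by (elim landau_o.bigE)
  obtain T1 where
    T1: "\<And>\<tau>. \<tau> \<ge> T1 \<Longrightarrow> norm (?f \<tau>) \<le> C1 * norm (of_real (\<tau> powi (m - int (n + p))) :: complex)"
    using C1 by (auto simp: eventually_at_top_linorder)
  obtain T2 where
    T2: "\<And>\<tau>. \<tau> \<le> T2 \<Longrightarrow> norm (?f \<tau>) \<le> C2 * norm (of_real (\<tau> powi (- int n)) :: complex)"
    using C2 by (auto simp: eventually_at_bot_linorder)
  define T where "T = max 1 (max \<bar>T1\<bar> \<bar>T2\<bar>)"
  have far: "norm (?f \<tau>) * (1 + \<bar>\<tau>\<bar>) ^ n \<le> max \<bar>C1\<bar> \<bar>C2\<bar> * 2 ^ n" if \<tau>: "\<bar>\<tau>\<bar> \<ge> T" for \<tau>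
  proof -
    have \<tau>1: "\<bar>\<tau>\<bar> \<ge> 1" using \<tau> by (simp add: T_def)
    have "norm (?f \<tau>) \<le> max \<bar>C1\<bar> \<bar>C2\<bar> * \<bar>\<tau>\<bar> powi (- int n)"
    proof (cases "\<tau> > 0")
      case True
      moreover have "T1 \<le> \<tau>" using \<tau> True unfolding T_def by linarith
      ultimately have "norm (?f \<tau>) \<le> C1 * \<bar>\<tau>\<bar> powi (m - int (n + p))"
        using T1[of \<tau>] by (simp add: norm_power_int)
      also have "\<dots> \<le> max \<bar>C1\<bar> \<bar>C2\<bar> * \<bar>\<tau>\<bar> powi (m - int (n + p))"
        by (intro mult_right_mono) auto
      also have "\<dots> \<le> max \<bar>C1\<bar> \<bar>C2\<bar> * \<bar>\<tau>\<bar> powi (- int n)"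
        using \<tau>1 \<open>m \<le> 0\<close> by (intro mult_left_mono power_int_increasing) auto
      finally show ?thesis .
    next
      case False
      moreover have "\<tau> \<le> T2" using \<tau> False unfolding T_def by linarith
      ultimately have "norm (?f \<tau>) \<le> C2 * \<bar>\<tau>\<bar> powi (- int n)"
        using T2[of \<tau>] by (simp add: norm_power_int power_int_abs)
      also have "\<dots> \<le> max \<bar>C1\<bar> \<bar>C2\<bar> * \<bar>\<tau>\<bar> powi (- int n)"
        by (intro mult_right_mono) auto
      finally show ?thesis .
    qed
    hence "norm (?f \<tau>) * (1 + \<bar>\<tau>\<bar>) ^ n \<le> max \<bar>C1\<bar> \<bar>C2\<bar> * \<bar>\<tau>\<bar> powi (- int n) * (2 * \<bar>\<tau>\<bar>) ^ n"
      using \<tau>1 by (intro mult_mono power_mono) auto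
    also have "\<dots> = max \<bar>C1\<bar> \<bar>C2\<bar> * 2 ^ n"
      using \<tau>1 by (simp add: power_int_minus power_mult_distrib field_simps)
    finally show ?thesis .
  qed
  have "continuous_on {-T..T} (\<lambda>\<tau>. norm (?f \<tau>) * (1 + \<bar>\<tau>\<bar>) ^ n)"
    by (intro continuous_intros continuous_on_subset[OF smooth_on_imp_continuous_on])
       (auto intro: smooth_on_nth_vderiv smooth)
  hence "bounded ((\<lambda>\<tau>. norm (?f \<tau>) * (1 + \<bar>\<tau>\<bar>) ^ n) ` {-T..T})"
    by (intro compact_imp_bounded compact_continuous_image) auto
  then obtain B where B: "\<And>\<tau>. \<bar>\<tau>\<bar> \<le> T \<Longrightarrow> norm (?f \<tau>) * (1 + \<bar>\<tau>\<bar>) ^ n \<le> B"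
    by (fastforce simp: bounded_iff abs_le_iff)
  show "\<exists>C. \<forall>\<tau>. norm (nth_vderiv n (nth_vderiv p \<Psi>) \<tau>) * (1 + \<bar>\<tau>\<bar>) ^ (n + 0) \<le> C"
    unfolding nth_vderiv_add
    by (intro exI[of _ "max B (max \<bar>C1\<bar> \<bar>C2\<bar> * 2 ^ n)"] allI)
       (use far B in \<open>smt (verit) add_0_right\<close>)
qed


section \<open>Boundary layer sums\<close>

text \<open>
  A summand has a profile that decays like \<open>\<tau> powi (- j)\<close>, and the factor \<open>k powr (j / 3)\<close>
  accompanies it: this is what \<open>j\<close> derivatives in \<open>s\<close> make of a profile of order zero. The index
  \<open>j\<close> is only an upper bound, since a derivative that falls on \<open>b\<close> does not raise it; this is the
  role of the rule \<open>weaken\<close>.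
\<close>

inductive layer_sum :: "(real \<Rightarrow> real) \<Rightarrow> real \<Rightarrow> nat \<Rightarrow> (real \<Rightarrow> real \<Rightarrow> complex) \<Rightarrow> bool"
  for Z :: "real \<Rightarrow> real" and e :: real where
  single: "smooth_on b UNIV \<Longrightarrow> decaying_symbol j \<Phi> \<Longrightarrow>
    layer_sum Z e j (\<lambda>s k. k powr (e + real j / 3) *\<^sub>R (b s * \<Phi> (k powr (1 / 3) * Z s)))"
| add: "layer_sum Z e j f \<Longrightarrow> layer_sum Z e j g \<Longrightarrow> layer_sum Z e j (\<lambda>s k. f s k + g s k)"
| weaken: "layer_sum Z e j f \<Longrightarrow> layer_sum Z e (Suc j) f"

lemma layer_single_derivative:
  fixes b \<Phi> :: "real \<Rightarrow> complex" and Z :: "real \<Rightarrow> real"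
  assumes "smooth_on b UNIV" "smooth_on \<Phi> UNIV" "smooth_on Z UNIV" "k > 0"
  shows "((\<lambda>(s, k). k powr c *\<^sub>R (b s * \<Phi> (k powr (1 / 3) * Z s))) has_derivative
     (\<lambda>h. fst h *\<^sub>R
        (k powr c *\<^sub>R (vector_derivative b (at s) * \<Phi> (k powr (1 / 3) * Z s)) +
         k powr (c + 1 / 3) *\<^sub>R (vector_derivative Z (at s) *\<^sub>R b s *
            vector_derivative \<Phi> (at (k powr (1 / 3) * Z s)))) +
      snd h *\<^sub>R (k powr (c - 1) *\<^sub>R (b s * euler_operator c \<Phi> (k powr (1 / 3) * Z s)))))
     (at (s, k))"
proof -
  let ?\<tau> = "k powr (1 / 3) * Z s"
  let ?b' = "vector_derivative b (at s)" and ?Z' = "vector_derivative Z (at s)"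
    and ?\<Phi>' = "vector_derivative \<Phi> (at ?\<tau>)"
  note d = smooth_on_real_derivative(1)[unfolded has_vector_derivative_def]
  have b: "((\<lambda>x. b (fst x)) has_derivative (\<lambda>h. fst h *\<^sub>R ?b')) (at (s, k))"
    using has_derivative_compose[OF has_derivative_fst[OF has_derivative_ident], of b _ "(s, k)"]
      d[OF assms(1), of s] by simp
  have Z: "((\<lambda>x. Z (fst x)) has_derivative (\<lambda>h. fst h * ?Z')) (at (s, k))"
    using has_derivative_compose[OF has_derivative_fst[OF has_derivative_ident], of Z _ "(s, k)"]
      d[OF assms(3), of s] by simp
  have pow: "((\<lambda>x::real\<times>real. snd x powr a) has_derivative (\<lambda>h. snd h * (a * k powr (a - 1)))) (at (s, k))"
    for a
  proof -
    have "((\<lambda>k. k powr a) has_derivative (\<lambda>h. h * (a * k powr (a - 1)))) (at k)"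
      using has_real_derivative_powr[OF assms(4), of a]
      by (simp add: has_real_derivative_iff_has_vector_derivative has_vector_derivative_def)
    thus ?thesis
      using has_derivative_compose[OF has_derivative_snd[OF has_derivative_ident],
          of "\<lambda>k. k powr a" _ "(s, k)"] by simp
  qed
  have \<tau>: "((\<lambda>x. snd x powr (1 / 3) * Z (fst x)) has_derivative
      (\<lambda>h. k powr (1 / 3) * (fst h * ?Z') + snd h * (1 / 3 * k powr (1 / 3 - 1)) * Z s)) (at (s, k))"
    using has_derivative_mult[OF pow[of "1/3"] Z] by simp
  have \<Phi>: "((\<lambda>x. \<Phi> (snd x powr (1 / 3) * Z (fst x))) has_derivative
      (\<lambda>h. (k powr (1 / 3) * (fst h * ?Z') + snd h * (1 / 3 * k powr (1 / 3 - 1)) * Z s) *\<^sub>R ?\<Phi>')) (at (s, k))"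
    using has_derivative_compose[OF \<tau>, of \<Phi>] d[OF assms(2), of ?\<tau>] by simp
  have total: "((\<lambda>x. snd x powr c *\<^sub>R (b (fst x) * \<Phi> (snd x powr (1 / 3) * Z (fst x)))) has_derivative
      (\<lambda>h. k powr c *\<^sub>R (b s * ((k powr (1 / 3) * (fst h * ?Z')
              + snd h * (1 / 3 * k powr (1 / 3 - 1)) * Z s) *\<^sub>R ?\<Phi>') + fst h *\<^sub>R ?b' * \<Phi> ?\<tau>)
         + (snd h * (c * k powr (c - 1))) *\<^sub>R (b s * \<Phi> ?\<tau>))) (at (s, k))"
    using has_derivative_scaleR[OF pow[of c] has_derivative_mult[OF b \<Phi>]] by simp
  have pows: "k powr (c + 1 / 3) = k powr c * k powr (1 / 3)" "k powr c = k * k powr (c - 1)"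
    "k powr (1 / 3) = k * k powr (1 / 3 - 1)"
    using assms(4) by (rule_tac powr_add, simp_all add: powr_mult_base)
  show ?thesis
    unfolding case_prod_unfold
  proof (rule has_derivative_eq_rhs[OF total], rule ext)
    fix h :: "real \<times> real"
    \<comment> \<open>Every power of \<open>k\<close> is written in terms of \<open>k\<close>, \<open>q\<close> and \<open>w\<close>; what remains is a ring identity.\<close>
    define q where "q = k powr (1 / 3 - 1)"
    define w where "w = k powr (c - 1)"
    show "k powr c *\<^sub>R (b s * ((k powr (1 / 3) * (fst h * ?Z')
              + snd h * (1 / 3 * k powr (1 / 3 - 1)) * Z s) *\<^sub>R ?\<Phi>') + fst h *\<^sub>R ?b' * \<Phi> ?\<tau>)
         + (snd h * (c * k powr (c - 1))) *\<^sub>R (b s * \<Phi> ?\<tau>) =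
      fst h *\<^sub>R (k powr c *\<^sub>R (?b' * \<Phi> ?\<tau>) + k powr (c + 1 / 3) *\<^sub>R (?Z' *\<^sub>R b s * ?\<Phi>')) +
      snd h *\<^sub>R (k powr (c - 1) *\<^sub>R (b s * euler_operator c \<Phi> ?\<tau>))"
      unfolding euler_operator_def pows(1)
      unfolding pows(2) unfolding w_def[symmetric]
      unfolding pows(3) unfolding q_def[symmetric]
      unfolding scaleR_conv_of_real of_real_mult of_real_add of_real_divide of_real_1 of_real_numeral
      by (simp add: algebra_simps)
  qed
qed

lemma layer_sum_derivatives:
  assumes "layer_sum Z e j f" and Z: "smooth_on Z UNIV"
  shows "\<exists>fs fk. layer_sum Z e (Suc j) fs \<and> layer_sum Z (e - 1) j fk \<and>
    (\<forall>s k. k > 0 \<longrightarrow> ((\<lambda>(s, k). f s k) has_derivative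
       (\<lambda>h. fst h *\<^sub>R fs s k + snd h *\<^sub>R fk s k)) (at (s, k)))"
  using assms(1)
proof (induction rule: layer_sum.induct)
  case (single b j \<Phi>)
  let ?c = "e + real j / 3"
  let ?fs = "\<lambda>s k. k powr ?c *\<^sub>R (vector_derivative b (at s) * \<Phi> (k powr (1 / 3) * Z s)) +
      k powr (?c + 1 / 3) *\<^sub>R (vector_derivative Z (at s) *\<^sub>R b s *
        vector_derivative \<Phi> (at (k powr (1 / 3) * Z s)))"
  let ?fk = "\<lambda>s k. k powr (?c - 1) *\<^sub>R (b s * euler_operator ?c \<Phi> (k powr (1 / 3) * Z s))"
  have \<Phi>: "smooth_on \<Phi> UNIV" using single decaying_symbol_def by blast
  have c: "?c + 1 / 3 = e + real (Suc j) / 3" by (simp add: add_divide_distrib)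
  have "layer_sum Z e (Suc j) (\<lambda>s k. k powr (?c + 1 / 3) *\<^sub>R
      (vector_derivative Z (at s) *\<^sub>R b s * vector_derivative \<Phi> (at (k powr (1 / 3) * Z s))))"
    unfolding c
    by (intro layer_sum.single[of "\<lambda>s. vector_derivative Z (at s) *\<^sub>R b s"]
          smooth_on_scaleR smooth_on_real_derivative(2) Z single
          decaying_symbol_derivative)
  hence fs: "layer_sum Z e (Suc j) ?fs"
    by (rule layer_sum.add[OF layer_sum.weaken[OF layer_sum.single], rotated 2])
       (intro smooth_on_real_derivative(2) single)+
  have "layer_sum Z (e - 1) j (\<lambda>s k. k powr (e - 1 + real j / 3) *\<^sub>R
      (b s * euler_operator ?c \<Phi> (k powr (1 / 3) * Z s)))"
    by (intro layer_sum.single single decaying_symbol_euler_operator)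
  hence "layer_sum Z (e - 1) j ?fk" by (simp add: algebra_simps)
  thus ?case
    using fs layer_single_derivative[OF single(1) \<Phi> Z] by blast
next
  case (add j f g)
  then obtain fs fk gs gk where
    l: "layer_sum Z e (Suc j) fs" "layer_sum Z e (Suc j) gs"
       "layer_sum Z (e - 1) j fk" "layer_sum Z (e - 1) j gk" and
    d: "\<forall>s k. k > 0 \<longrightarrow> ((\<lambda>(s, k). f s k) has_derivative
       (\<lambda>h. fst h *\<^sub>R fs s k + snd h *\<^sub>R fk s k)) (at (s, k))"
     "\<forall>s k. k > 0 \<longrightarrow> ((\<lambda>(s, k). g s k) has_derivative
       (\<lambda>h. fst h *\<^sub>R gs s k + snd h *\<^sub>R gk s k)) (at (s, k))"
    by blast
  have "((\<lambda>(s, k). f s k + g s k) has_derivative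
      (\<lambda>h. fst h *\<^sub>R (fs s k + gs s k) + snd h *\<^sub>R (fk s k + gk s k))) (at (s, k))"
    if "k > 0" for s k
    using has_derivative_add[OF d(1)[rule_format, OF that, of s] d(2)[rule_format, OF that, of s]]
    by (simp add: case_prod_unfold algebra_simps)
  thus ?case
    using layer_sum.add[OF l(1,2)] layer_sum.add[OF l(3,4)]
    by (intro exI[of _ "\<lambda>s k. fs s k + gs s k"] exI[of _ "\<lambda>s k. fk s k + gk s k"]) simp
next
  case (weaken j f)
  thus ?case using layer_sum.weaken by meson
qed

lemma strip_smooth_layer_sum:
  assumes "smooth_on Z UNIV" "layer_sum Z e j f"
  shows "strip_smooth L f"
proof (rule smooth_on_coinduct[where X = "\<lambda>F. \<exists>e j f. layer_sum Z e j f \<and> F = (\<lambda>(s, k). f s k)"])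
  show "\<exists>e j f'. layer_sum Z e j f' \<and> (\<lambda>(s, k). f s k) = (\<lambda>(s, k). f' s k)"
    using assms(2) by (intro exI[of _ e] exI[of _ j] exI[of _ f]) simp
next
  fix F :: "real \<times> real \<Rightarrow> complex"
  assume "\<exists>e j f. layer_sum Z e j f \<and> F = (\<lambda>(s, k). f s k)"
  then obtain e j f where f: "layer_sum Z e j f" "F = (\<lambda>(s, k). f s k)" by blast
  obtain fs fk where d: "layer_sum Z e (Suc j) fs" "layer_sum Z (e - 1) j fk"
    "\<And>s k. k > 0 \<Longrightarrow> (F has_derivative (\<lambda>h. fst h *\<^sub>R fs s k + snd h *\<^sub>R fk s k)) (at (s, k))"
    using layer_sum_derivatives[OF f(1) assms(1)] f(2) by blast
  let ?D = "\<lambda>x h. fst h *\<^sub>R (\<lambda>(s, k). fs s k) x + snd h *\<^sub>R (\<lambda>(s, k). fk s k) x"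
  have "\<forall>x\<in>strip L. (F has_derivative ?D x) (at x within strip L)"
    using d(3) by (auto intro: has_derivative_at_withinI)
  moreover have "\<forall>v\<in>Basis. \<exists>e j f. layer_sum Z e j f \<and> (\<lambda>x. ?D x v) = (\<lambda>(s, k). f s k)"
    using d(1,2) by (auto simp: Basis_prod_def)
  ultimately show "\<exists>D. (\<forall>x\<in>strip L. (F has_derivative D x) (at x within strip L)) \<and>
      (\<forall>v\<in>Basis. \<exists>e j f. layer_sum Z e j f \<and> (\<lambda>x. D x v) = (\<lambda>(s, k). f s k))"
    by (intro exI[of _ ?D] conjI)
qed

lemma layer_sum_mixed:
  assumes "L > 0" "smooth_on Z UNIV" "layer_sum Z e j f"
  shows "\<exists>g. layer_sum Z (e - real m) (j + n) g \<and>
    (\<forall>s\<in>{0..L}. \<forall>k>0. mixed L n m f s k = g s k)"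
proof -
  have partial: "\<exists>fs fk. layer_sum Z e (Suc j) fs \<and> layer_sum Z (e - 1) j fk \<and>
      (\<forall>s\<in>{0..L}. \<forall>k>0. D_s L f s k = fs s k \<and> D_k f s k = fk s k)"
    if f: "layer_sum Z e j f" for e j f
  proof -
    obtain fs fk where d: "layer_sum Z e (Suc j) fs" "layer_sum Z (e - 1) j fk"
      "\<And>s k. k > 0 \<Longrightarrow> ((\<lambda>(s, k). f s k) has_derivative
          (\<lambda>h. fst h *\<^sub>R fs s k + snd h *\<^sub>R fk s k)) (at (s, k))"
      using layer_sum_derivatives[OF f assms(2)] by blast
    have "D_s L f s k = fs s k \<and> D_k f s k = fk s k" if "s \<in> {0..L}" "k > 0" for s k
      using partial_derivatives(3,4)[OF assms(1) that has_derivative_at_withinI[OF d(3)[OF that(2)]]]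
      by simp
    thus ?thesis using d(1,2) by blast
  qed
  have "\<exists>g. layer_sum Z (e - real m) j g \<and> (\<forall>s\<in>{0..L}. \<forall>k>0. (D_k ^^ m) f s k = g s k)"
  proof (induction m)
    case 0
    thus ?case using assms(3) by auto
  next
    case (Suc m)
    then obtain g where g: "layer_sum Z (e - real m) j g"
      "\<And>s k. s \<in> {0..L} \<Longrightarrow> k > 0 \<Longrightarrow> (D_k ^^ m) f s k = g s k" by blast
    obtain gk where "layer_sum Z (e - real m - 1) j gk"
      "\<forall>s\<in>{0..L}. \<forall>k>0. D_k g s k = gk s k" using partial[OF g(1)] by blast
    thus ?case using D_k_cong[OF g(2)] by (intro exI[of _ gk]) (auto simp: algebra_simps)
  qed
  then obtain g0 where g0: "layer_sum Z (e - real m) j g0"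
    "\<And>s k. s \<in> {0..L} \<Longrightarrow> k > 0 \<Longrightarrow> (D_k ^^ m) f s k = g0 s k" by blast
  show ?thesis
  proof (induction n)
    case 0
    thus ?case using g0 by auto
  next
    case (Suc n)
    then obtain g where g: "layer_sum Z (e - real m) (j + n) g"
      "\<And>s k. s \<in> {0..L} \<Longrightarrow> k > 0 \<Longrightarrow> mixed L n m f s k = g s k" by blast
    obtain gs where "layer_sum Z (e - real m) (Suc (j + n)) gs"
      "\<forall>s\<in>{0..L}. \<forall>k>0. D_s L g s k = gs s k" using partial[OF g(1)] by blast
    thus ?case using D_s_cong[OF g(2)] by (intro exI[of _ gs]) auto
  qed
qed

lemma W_pos: "k > 0 \<Longrightarrow> W t1 t2 s k > 0"
  by (simp add: W_def add_pos_nonneg)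

lemma W_bounded: "k0 > 0 \<Longrightarrow> \<exists>B>0. \<forall>s\<in>{0..L}. \<forall>k\<ge>k0. W t1 t2 s k \<le> B"
proof -
  assume k0: "k0 > 0"
  have "bounded (omega t1 t2 ` {0..L})"
    unfolding omega_def by (intro compact_imp_bounded compact_continuous_image continuous_intros) auto
  then obtain B where B: "\<And>s. s \<in> {0..L} \<Longrightarrow> \<bar>omega t1 t2 s\<bar> \<le> B"
    by (force simp: bounded_iff)
  have "W t1 t2 s k \<le> k0 powr (- 1 / 3) + \<bar>B\<bar>" if "s \<in> {0..L}" "k \<ge> k0" for s k
  proof -
    have "k powr (- 1 / 3) \<le> k0 powr (- 1 / 3)"
      using that k0 by (intro powr_mono2') auto
    thus ?thesis unfolding W_def using B[OF that(1)] by linarith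
  qed
  moreover have "k0 powr (- 1 / 3) + \<bar>B\<bar> > 0" using k0 by (intro add_pos_nonneg) auto
  ultimately show ?thesis by blast
qed

text \<open>
  The factor \<open>k powr (j / 3)\<close> turns the decay \<open>(1 + \<bar>\<tau>\<bar>) powi (- j)\<close> of the profile into
  \<open>(k powr (-1/3) + \<bar>Z s\<bar>) powi (- j)\<close>, and \<open>\<bar>Z s\<bar>\<close> dominates \<open>\<bar>\<omega> s\<bar>\<close>. The rule \<open>weaken\<close> is harmless
  because \<open>W\<close> is bounded above for \<open>k \<ge> k0\<close>.
\<close>

lemma layer_sum_bound:
  assumes "layer_sum Z e j f" and "c > 0" and "k0 > 0"
    and Z: "\<And>s. s \<in> {0..L} \<Longrightarrow> c * \<bar>omega t1 t2 s\<bar> \<le> \<bar>Z s\<bar>"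
  shows "\<exists>C\<ge>0. \<forall>s\<in>{0..L}. \<forall>k\<ge>k0. norm (f s k) \<le> C * (k powr e / W t1 t2 s k ^ j)"
  using assms(1)
proof (induction rule: layer_sum.induct)
  case (single b j \<Phi>)
  have "continuous_on {0..L} b"
    using smooth_on_imp_continuous_on[OF single(1)] continuous_on_subset by blast
  hence "bounded (b ` {0..L})" by (intro compact_imp_bounded compact_continuous_image) auto
  then obtain B where B: "B > 0" "\<And>s. s \<in> {0..L} \<Longrightarrow> norm (b s) \<le> B"
    by (force simp: bounded_pos)
  obtain C where C: "\<And>\<tau>. norm (\<Phi> \<tau>) * (1 + \<bar>\<tau>\<bar>) ^ j \<le> C"
    using single(2) unfolding decaying_symbol_def by (metis add_0 nth_vderiv_0)
  have C0: "C \<ge> 0" using C[of 0]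
    by (smt (verit) norm_ge_zero power_one mult_cancel_left2 abs_zero mult_nonneg_nonneg)
  \<comment> \<open>The summand \<open>k powr (-1/3)\<close> of \<open>W\<close> needs \<open>c1 \<le> 1\<close>, the summand \<open>\<bar>\<omega>\<bar>\<close> needs \<open>c1 \<le> c\<close>.\<close>
  define c1 where "c1 = min c 1"
  have c1: "c1 > 0" "c1 \<le> c" "c1 \<le> 1" using assms(2) by (auto simp: c1_def)
  have "norm (k powr (e + real j / 3) *\<^sub>R (b s * \<Phi> (k powr (1 / 3) * Z s)))
          \<le> B * C / c1 ^ j * (k powr e / W t1 t2 s k ^ j)" if sk: "s \<in> {0..L}" "k \<ge> k0" for s k
  proof -
    define \<tau> where "\<tau> = k powr (1 / 3) * Z s"
    have k: "k > 0" using sk assms(3) by simp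
    have "k powr (1 / 3) * (c1 * W t1 t2 s k)
            = c1 * (k powr (1 / 3) * k powr (- 1 / 3)) + k powr (1 / 3) * (c1 * \<bar>omega t1 t2 s\<bar>)"
      by (simp add: W_def algebra_simps)
    also have "\<dots> = c1 + k powr (1 / 3) * (c1 * \<bar>omega t1 t2 s\<bar>)"
      using k by (simp flip: powr_add)
    also have "\<dots> \<le> 1 + k powr (1 / 3) * \<bar>Z s\<bar>"
    proof -
      have "c1 * \<bar>omega t1 t2 s\<bar> \<le> c * \<bar>omega t1 t2 s\<bar>" using c1 by (simp add: mult_right_mono)
      also have "\<dots> \<le> \<bar>Z s\<bar>" using Z sk by blast
      finally show ?thesis using c1 by (intro add_mono mult_left_mono) auto
    qed
    also have "\<dots> = 1 + \<bar>\<tau>\<bar>" by (simp add: \<tau>_def abs_mult)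
    finally have W: "(k powr (1 / 3) * (c1 * W t1 t2 s k)) ^ j \<le> (1 + \<bar>\<tau>\<bar>) ^ j"
      using c1 W_pos[OF k, of t1 t2 s] by (intro power_mono) auto
    have "norm (\<Phi> \<tau>) * (k powr (1 / 3) * (c1 * W t1 t2 s k)) ^ j \<le> norm (\<Phi> \<tau>) * (1 + \<bar>\<tau>\<bar>) ^ j"
      by (rule mult_left_mono[OF W]) simp
    also have "\<dots> \<le> C" by (rule C)
    finally have "norm (\<Phi> \<tau>) * k powr (real j / 3) * c1 ^ j * W t1 t2 s k ^ j \<le> C"
      using k by (simp add: power_mult_distrib powr_power mult.assoc)
    hence "norm (\<Phi> \<tau>) * k powr (real j / 3) \<le> C / (c1 ^ j * W t1 t2 s k ^ j)"
      using c1 W_pos[OF k, of t1 t2 s] by (simp add: field_simps)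
    hence "norm (b s) * (norm (\<Phi> \<tau>) * k powr (real j / 3)) \<le> B * (C / (c1 ^ j * W t1 t2 s k ^ j))"
      using B sk by (intro mult_mono) auto
    hence "k powr e * (norm (b s) * (norm (\<Phi> \<tau>) * k powr (real j / 3)))
        \<le> k powr e * (B * (C / (c1 ^ j * W t1 t2 s k ^ j)))"
      by (rule mult_left_mono) simp
    thus ?thesis by (simp add: \<tau>_def norm_mult powr_add mult_ac)
  qed
  thus ?case using B(1) C0 c1(1) by (intro exI[of _ "B * C / c1 ^ j"]) auto
next
  case (add j f g)
  then obtain C D where CD: "C \<ge> 0" "D \<ge> 0"
    "\<forall>s\<in>{0..L}. \<forall>k\<ge>k0. norm (f s k) \<le> C * (k powr e / W t1 t2 s k ^ j)"
    "\<forall>s\<in>{0..L}. \<forall>k\<ge>k0. norm (g s k) \<le> D * (k powr e / W t1 t2 s k ^ j)"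
    by blast
  show ?case
  proof (intro exI[of _ "C + D"] conjI ballI allI impI)
    fix s k assume "s \<in> {0..L}" "k \<ge> k0"
    thus "norm (f s k + g s k) \<le> (C + D) * (k powr e / W t1 t2 s k ^ j)"
      using CD(3,4) norm_triangle_ineq[of "f s k" "g s k"] unfolding distrib_right
      by (meson add_mono order_trans)
  qed (use CD in simp)
next
  case (weaken j f)
  then obtain C where C: "C \<ge> 0"
    "\<And>s k. s \<in> {0..L} \<Longrightarrow> k \<ge> k0 \<Longrightarrow> norm (f s k) \<le> C * (k powr e / W t1 t2 s k ^ j)"
    by blast
  obtain B where B: "B > 0" "\<And>s k. s \<in> {0..L} \<Longrightarrow> k \<ge> k0 \<Longrightarrow> W t1 t2 s k \<le> B"
    using W_bounded[OF assms(3)] by blast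
  show ?case
  proof (intro exI[of _ "C * B"] conjI ballI allI impI)
    fix s k assume sk: "s \<in> {0..L}" "k \<ge> k0"
    have W: "W t1 t2 s k > 0" using W_pos sk assms(3) by simp
    have "norm (f s k) \<le> C * (k powr e / W t1 t2 s k ^ j)" using C sk by blast
    also have "\<dots> \<le> C * (B * (k powr e / W t1 t2 s k ^ Suc j))"
    proof (rule mult_left_mono)
      have "W t1 t2 s k * (k powr e / W t1 t2 s k ^ Suc j) \<le> B * (k powr e / W t1 t2 s k ^ Suc j)"
        using B(2)[OF sk] W by (intro mult_right_mono) auto
      thus "k powr e / W t1 t2 s k ^ j \<le> B * (k powr e / W t1 t2 s k ^ Suc j)" using W by simp
    qed (use C in simp)
    finally show "norm (f s k) \<le> C * B * (k powr e / W t1 t2 s k ^ Suc j)" by (simp add: mult.assoc)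
  qed (use C B in simp)
qed

lemma powr_le_const_powr:
  fixes k :: real
  assumes "x \<le> y" "0 < k0" "k0 \<le> k"
  shows "k powr x \<le> k0 powr (x - y) * k powr y"
proof -
  have "k powr x = k powr (x - y) * k powr y" by (simp flip: powr_add)
  also have "\<dots> \<le> k0 powr (x - y) * k powr y"
    using assms by (intro mult_right_mono powr_mono2') auto
  finally show ?thesis .
qed

lemma symbol_class_iff:
  "a \<in> symbol_class \<mu> \<rho> \<delta> L \<longleftrightarrow> strip_smooth L a \<and>
    (\<forall>n m. \<forall>k0>0. mixed_bounded L n m k0 (\<lambda>s k. k powr (\<mu> + \<delta> * real n - \<rho> * real m)) a)"
  by (simp add: symbol_class_def mixed_bounded_def)

lemma symbol_class_mono:
  assumes "\<mu>' \<le> \<mu>"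
  shows "symbol_class \<mu>' \<rho> \<delta> L \<subseteq> symbol_class \<mu> \<rho> \<delta> L"
proof
  fix a assume a: "a \<in> symbol_class \<mu>' \<rho> \<delta> L"
  have "mixed_bounded L n m k0 (\<lambda>s k. k powr (\<mu> + \<delta> * real n - \<rho> * real m)) a" if "k0 > 0" for n m k0
  proof (rule mixed_bounded_mono)
    show "mixed_bounded L n m k0 (\<lambda>s k. k powr (\<mu>' + \<delta> * real n - \<rho> * real m)) a"
      using a that unfolding symbol_class_iff by blast
    show "0 \<le> k powr (\<mu>' + \<delta> * real n - \<rho> * real m) \<and> k powr (\<mu>' + \<delta> * real n - \<rho> * real m)
        \<le> k0 powr (\<mu>' + \<delta> * real n - \<rho> * real m - (\<mu> + \<delta> * real n - \<rho> * real m))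
           * k powr (\<mu> + \<delta> * real n - \<rho> * real m)"
      if "k0 \<le> k" for k
      using assms that \<open>k0 > 0\<close> by (intro conjI powr_le_const_powr) auto
  qed
  thus "a \<in> symbol_class \<mu> \<rho> \<delta> L" using a unfolding symbol_class_iff by blast
qed

lemma symbol_class_add_sum:
  assumes "L > 0" "finite I" "f \<in> symbol_class \<mu> \<rho> \<delta> L"
    and "\<And>i. i \<in> I \<Longrightarrow> g i \<in> symbol_class \<mu> \<rho> \<delta> L"
  shows "(\<lambda>s k. f s k + (\<Sum>i\<in>I. g i s k)) \<in> symbol_class \<mu> \<rho> \<delta> L"
  using assms unfolding symbol_class_iff
  by (auto intro!: strip_smooth_add_sum mixed_bounded_add_sum)

lemma layer_sum_mixed_bounded:
  assumes "L > 0" "smooth_on Z UNIV" "layer_sum Z e 0 f" "c > 0" "k0 > 0"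
    and "\<And>s. s \<in> {0..L} \<Longrightarrow> c * \<bar>omega t1 t2 s\<bar> \<le> \<bar>Z s\<bar>"
  shows "mixed_bounded L n m k0 (\<lambda>s k. k powr (e - real m) / W t1 t2 s k ^ n) f"
proof -
  obtain g where g: "layer_sum Z (e - real m) n g"
    "\<forall>s\<in>{0..L}. \<forall>k>0. mixed L n m f s k = g s k"
    using layer_sum_mixed[OF assms(1-3), of m n] by auto
  obtain C where "\<forall>s\<in>{0..L}. \<forall>k\<ge>k0. norm (g s k) \<le> C * (k powr (e - real m) / W t1 t2 s k ^ n)"
    using layer_sum_bound[OF g(1) assms(4-6)] by blast
  thus ?thesis
    unfolding mixed_bounded_def using g(2) assms(5) by (intro exI[of _ C]) auto
qed

text \<open>
  Each derivative in \<open>s\<close> costs at most \<open>1 / W \<le> k powr (1/3)\<close>, and each one in \<open>k\<close> even gains a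
  full power of \<open>k\<close>, more than the \<open>2/3\<close> that the class demands.
\<close>

lemma layer_sum_in_symbol_class:
  assumes "L > 0" "smooth_on Z UNIV" "layer_sum Z e 0 f" "c > 0"
    and "\<And>s. s \<in> {0..L} \<Longrightarrow> c * \<bar>omega t1 t2 s\<bar> \<le> \<bar>Z s\<bar>"
  shows "f \<in> symbol_class e (2 / 3) (1 / 3) L"
  unfolding symbol_class_iff
proof (intro conjI allI impI)
  show "strip_smooth L f" by (rule strip_smooth_layer_sum[OF assms(2,3)])
  fix n m and k0 :: real assume k0: "k0 > 0"
  show "mixed_bounded L n m k0 (\<lambda>s k. k powr (e + 1 / 3 * real n - 2 / 3 * real m)) f"
  proof (rule mixed_bounded_mono[OF layer_sum_mixed_bounded[OF assms(1-4) k0 assms(5)]])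
    fix s k assume k: "k0 \<le> k"
    have W: "W t1 t2 s k > 0" using W_pos k k0 by simp
    have "k powr (- real n / 3) = (k powr (- 1 / 3)) ^ n" using k k0 by (simp add: powr_power)
    also have "\<dots> \<le> W t1 t2 s k ^ n" by (intro power_mono) (auto simp: W_def)
    finally have Wn: "k powr (- real n / 3) \<le> W t1 t2 s k ^ n" .
    have "k powr (e - real m) / W t1 t2 s k ^ n \<le> k powr (e - real m) / k powr (- real n / 3)"
      using Wn W k k0 by (intro divide_left_mono mult_pos_pos) auto
    also have "\<dots> = k powr (e - real m + real n / 3)" by (simp flip: powr_diff)
    also have "\<dots> \<le> k0 powr ((e - real m + real n / 3) - (e + 1 / 3 * real n - 2 / 3 * real m))
        * k powr (e + 1 / 3 * real n - 2 / 3 * real m)"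
      using k k0 by (intro powr_le_const_powr) auto
    finally show "0 \<le> k powr (e - real m) / W t1 t2 s k ^ n \<and> k powr (e - real m) / W t1 t2 s k ^ n
       \<le> k0 powr ((e - real m + real n / 3) - (e + 1 / 3 * real n - 2 / 3 * real m))
        * k powr (e + 1 / 3 * real n - 2 / 3 * real m)"
      using W by simp
  qed
qed


section \<open>Application to the envelope\<close>

text \<open>
  The quotient of \<open>Z\<close> and \<open>\<omega>\<close> extends continuously to the common zeros, with the quotient of the
  derivatives as its value (l'Hopital), and the extension has no zero on the compact interval.
\<close>

lemma simple_zeros_bound_below:
  fixes Z :: "real \<Rightarrow> real"
  assumes "t1 < t2" "L > 0" and smooth: "smooth_on Z UNIV"
    and zeros: "\<And>t. t \<in> {t1, t2} \<Longrightarrow> Z t = 0 \<and> vector_derivative Z (at t) \<noteq> 0"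
    and nonzero: "\<And>s. s \<in> {0..L} - {t1, t2} \<Longrightarrow> Z s \<noteq> 0"
  shows "\<exists>c>0. \<forall>s\<in>{0..L}. c * \<bar>omega t1 t2 s\<bar> \<le> \<bar>Z s\<bar>"
proof -
  define q where "q s = (if omega t1 t2 s = 0 then vector_derivative Z (at s) / (t1 + t2 - 2 * s)
                          else Z s / omega t1 t2 s)" for s
  have omega_0: "omega t1 t2 s = 0 \<longleftrightarrow> s \<in> {t1, t2}" for s by (auto simp: omega_def)
  have Z': "(Z has_real_derivative vector_derivative Z (at s)) (at s)" for s
    using smooth_on_real_derivative(1)[OF smooth]
    by (simp add: has_real_derivative_iff_has_vector_derivative)
  have \<omega>': "(omega t1 t2 has_real_derivative (t1 + t2 - 2 * s)) (at s)" for s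
    unfolding omega_def [abs_def] by (auto intro!: derivative_eq_intros)
  have off: "eventually (\<lambda>s'. omega t1 t2 s' \<noteq> 0) (at s)" for s
  proof -
    have "eventually (\<lambda>s'. s' \<noteq> t1) (at s)" "eventually (\<lambda>s'. s' \<noteq> t2) (at s)"
      by (rule eventually_neq_at_within)+
    thus ?thesis by eventually_elim (simp add: omega_0)
  qed
  have "isCont q s" for s
    unfolding isCont_def
  proof (rule Lim_transform_eventually)
    show "eventually (\<lambda>s'. Z s' / omega t1 t2 s' = q s') (at s)"
      using off by eventually_elim (simp add: q_def)
    show "((\<lambda>s'. Z s' / omega t1 t2 s') \<longlongrightarrow> q s) (at s)"
    proof (cases "omega t1 t2 s = 0")
      case False
      have "((\<lambda>s'. Z s' / omega t1 t2 s') \<longlongrightarrow> Z s / omega t1 t2 s) (at s)"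
        using DERIV_isCont[OF Z'[of s]] DERIV_isCont[OF \<omega>'[of s]] False
        unfolding isCont_def by (intro tendsto_divide)
      thus ?thesis using False by (simp add: q_def)
    next
      case True
      have "((\<lambda>s'. ((Z s' - Z s) / (s' - s)) / ((omega t1 t2 s' - omega t1 t2 s) / (s' - s)))
          \<longlongrightarrow> vector_derivative Z (at s) / (t1 + t2 - 2 * s)) (at s)"
      proof (rule tendsto_divide)
        show "t1 + t2 - 2 * s \<noteq> 0" using True assms(1) by (auto simp: omega_0)
      qed (use Z'[of s] \<omega>'[of s] in \<open>simp_all only: has_field_derivative_iff\<close>)
      moreover have "Z s = 0" using zeros True omega_0 by blast
      ultimately have lim: "((\<lambda>s'. (Z s' / (s' - s)) / (omega t1 t2 s' / (s' - s))) \<longlongrightarrow> q s) (at s)"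
        using True by (simp add: q_def)
      have "eventually (\<lambda>s'. s' \<noteq> s) (at s)" by (rule eventually_neq_at_within)
      hence "eventually (\<lambda>s'. (Z s' / (s' - s)) / (omega t1 t2 s' / (s' - s))
                 = Z s' / omega t1 t2 s') (at s)"
        by eventually_elim simp
      with lim show ?thesis by (rule Lim_transform_eventually)
    qed
  qed
  hence "continuous_on {0..L} (\<lambda>s. \<bar>q s\<bar>)"
    by (intro continuous_intros continuous_at_imp_continuous_on) auto
  then obtain s0 where s0: "s0 \<in> {0..L}" "\<forall>s\<in>{0..L}. \<bar>q s0\<bar> \<le> \<bar>q s\<bar>"
    using continuous_attains_inf[of "{0..L}" "\<lambda>s. \<bar>q s\<bar>"] assms(2) by auto
  have "q s0 \<noteq> 0"
    using zeros[of s0] nonzero[of s0] s0(1) omega_0[of s0] assms(1) by (auto simp: q_def)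
  moreover have "\<bar>q s0\<bar> * \<bar>omega t1 t2 s\<bar> \<le> \<bar>Z s\<bar>" if s: "s \<in> {0..L}" for s
  proof (cases "omega t1 t2 s = 0")
    case False
    have "\<bar>q s0\<bar> * \<bar>omega t1 t2 s\<bar> \<le> \<bar>q s\<bar> * \<bar>omega t1 t2 s\<bar>"
      using s0(2) s by (intro mult_right_mono) auto
    also have "\<dots> = \<bar>Z s\<bar>" using False by (simp add: q_def abs_divide)
    finally show ?thesis .
  qed simp
  ultimately show ?thesis by (intro exI[of _ "\<bar>q s0\<bar>"]) auto
qed

text \<open>
  As \<open>l \<le> -1\<close>, the number \<open>1 + l - 2 r - p\<close> is at most zero. The second branch in the definition
  of \<open>vartheta\<close> is therefore taken only where its value is zero, and \<open>vartheta i\<close> is the exponent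
  of \<open>k\<close>.
\<close>

lemma slow_term_layer_sum:
  assumes "i \<in> indices"
    and b: "\<And>p q r l. l \<le> -1 \<Longrightarrow> smooth_on (b p q r l) UNIV"
    and \<Psi>: "\<And>r l. l \<le> -1 \<Longrightarrow> smooth_on (\<Psi> r l) UNIV \<and>
       symbol_expansion_at_top (\<Psi> r l) (1 + l - 2 * int r) (a r l) \<and>
       rapidly_decreasing_at_bot (\<Psi> r l)"
  shows "layer_sum Z (vartheta i) 0 (slow_term b Z \<Psi> i)"
proof -
  obtain p q r l where i: "i = (p, q, r, l)" by (cases i)
  have l: "l \<le> -1" using assms(1) by (simp add: i indices_def)
  have "decaying_symbol 0 (nth_vderiv p (\<Psi> r l))"
    using \<Psi>[OF l] l by (intro decaying_symbol_nth_vderiv[where m = "1 + l - 2 * int r"]) auto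
  hence "layer_sum Z (vartheta i) 0 (\<lambda>s k. k powr (vartheta i + real 0 / 3) *\<^sub>R
      (b p q r l s * nth_vderiv p (\<Psi> r l) (k powr (1 / 3) * Z s)))"
    by (intro layer_sum.single b l)
  moreover have "vartheta i = - (1 + 2 * real p + 3 * real q + real r + of_int l) / 3
      + neg_part (of_int l + 1)"
    using l by (simp add: i)
  hence "slow_term b Z \<Psi> i = (\<lambda>s k. k powr (vartheta i + real 0 / 3) *\<^sub>R
      (b p q r l s * nth_vderiv p (\<Psi> r l) (k powr (1 / 3) * Z s)))"
    by (intro ext) (simp add: i scaleR_conv_of_real mult.assoc del: vartheta.simps)
  ultimately show ?thesis by simp
qed

theorem theorem7:
  fixes K :: "(real^2) set" and P t1 t2 :: real
    and \<gamma> :: "real \<Rightarrow> real^2" and \<nu> :: "real^2 \<Rightarrow> real^2" and \<alpha> :: "real^2"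
    and u :: "real \<Rightarrow> real^2 \<Rightarrow> complex"
    and b :: "nat \<Rightarrow> nat \<Rightarrow> nat \<Rightarrow> int \<Rightarrow> real \<Rightarrow> complex"
    and Z :: "real \<Rightarrow> real" and \<Psi> :: "nat \<Rightarrow> int \<Rightarrow> real \<Rightarrow> complex"
    and a :: "nat \<Rightarrow> int \<Rightarrow> nat \<Rightarrow> complex"
    and \<beta> :: nat
  assumes obstacle: "convex_obstacle K P \<gamma> \<nu>"
    and direction: "norm \<alpha> = 1"
    and shadow: "shadow_points P \<gamma> \<nu> \<alpha> t1 t2"
    and solution: "\<And>k. k > 0 \<Longrightarrow> scattered_field K \<nu> \<alpha> k (u k)"
    and expansion: "slow_expansion P t1 t2 (eta_slow \<gamma> \<alpha> u) b Z \<Psi> a"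
  shows "rho_slow \<beta> (eta_slow \<gamma> \<alpha> u) b Z \<Psi> \<in> symbol_class (- real \<beta> / 3) (2/3) (1/3) (2 * P) \<and>
    (\<forall>k0>1. \<forall>n. \<exists>C>0. \<forall>s\<in>{0..2 * P}. \<forall>k\<ge>k0.
       norm ((D_s (2 * P) ^^ n) (rho_slow \<beta> (eta_slow \<gamma> \<alpha> u) b Z \<Psi>) s k)
         \<le> C * k powr (- real \<beta> / 3) * W t1 t2 s k powi (- int n))"
proof -
  let ?L = "2 * P" and ?\<eta> = "eta_slow \<gamma> \<alpha> u"
  let ?\<rho> = "rho_slow \<beta> ?\<eta> b Z \<Psi>" and ?T = "slow_term b Z \<Psi>"
  have t: "0 < t1" "t1 < t2" "t2 < ?L" using shadow by (auto simp: shadow_points_def)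
  have L: "?L > 0" using t by simp
  note E = expansion[unfolded slow_expansion_def]
  have Z: "smooth_on Z UNIV"
    and sign: "\<forall>s\<in>{t1<..<t2}. Z s > 0" "\<forall>s\<in>{0..<t1} \<union> {t2<..?L}. Z s < 0"
    and zeros: "\<forall>t\<in>{t1, t2}. Z t = 0 \<and> vector_derivative Z (at t) \<noteq> 0"
    and b: "\<forall>p q r. \<forall>l\<le>-1. smooth_on (b p q r l) UNIV \<and> periodic ?L (b p q r l)"
    and \<Psi>: "\<forall>r. \<forall>l\<le>-1. smooth_on (\<Psi> r l) UNIV \<and>
       symbol_expansion_at_top (\<Psi> r l) (1 + l - 2 * int r) (a r l) \<and>
       rapidly_decreasing_at_bot (\<Psi> r l)"
    and remainders: "\<forall>M>0. \<exists>F0. finite F0 \<and> F0 \<subseteq> indices \<and>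
       (\<forall>F. finite F \<and> F0 \<subseteq> F \<and> F \<subseteq> indices \<longrightarrow>
          (\<lambda>s k. ?\<eta> s k - (\<Sum>i\<in>F. ?T i s k)) \<in> symbol_class (- M) (2/3) (1/3) ?L)"
    using E by - (elim conjE, assumption)+
  have "Z s \<noteq> 0" if "s \<in> {0..?L} - {t1, t2}" for s
  proof -
    have "s \<in> {t1<..<t2} \<or> s \<in> {0..<t1} \<union> {t2<..?L}" using that by auto
    thus ?thesis using sign by (metis less_irrefl)
  qed
  then obtain c where c: "c > 0" "\<And>s. s \<in> {0..?L} \<Longrightarrow> c * \<bar>omega t1 t2 s\<bar> \<le> \<bar>Z s\<bar>"
    using simple_zeros_bound_below[OF t(2) L Z zeros[rule_format]] by metis
  have layer: "layer_sum Z (vartheta i) 0 (?T i)" if "i \<in> indices" for i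
    using that b \<Psi> by (intro slow_term_layer_sum[where a = a]) simp_all
  \<comment> \<open>\<open>F0\<close> need not contain \<open>index_cut \<beta>\<close>; enlarging it by that set is harmless for the remainder,
     and the surplus over \<open>index_cut \<beta>\<close> consists of terms of low order.\<close>
  have decomposition: "\<exists>R I. R \<in> symbol_class (- M) (2/3) (1/3) ?L \<and> finite I \<and>
      (\<forall>i\<in>I. i \<in> indices \<and> vartheta i \<le> - real \<beta> / 3) \<and>
      ?\<rho> = (\<lambda>s k. R s k + (\<Sum>i\<in>I. ?T i s k))" if "M > 0" for M
  proof -
    obtain F0 where F0: "finite F0" "F0 \<subseteq> indices"
      "\<forall>F. finite F \<and> F0 \<subseteq> F \<and> F \<subseteq> indices \<longrightarrow>
          (\<lambda>s k. ?\<eta> s k - (\<Sum>i\<in>F. ?T i s k)) \<in> symbol_class (- M) (2/3) (1/3) ?L"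
      using remainders[rule_format, OF \<open>M > 0\<close>] by (elim exE conjE)
    let ?F = "F0 \<union> index_cut \<beta>" and ?I = "(F0 \<union> index_cut \<beta>) - index_cut \<beta>"
    have F: "finite ?F" "?F \<subseteq> indices"
      using F0 finite_index_cut by (auto simp: index_cut_def)
    have "(\<Sum>i\<in>?F. ?T i s k) = (\<Sum>i\<in>?I. ?T i s k) + (\<Sum>i\<in>index_cut \<beta>. ?T i s k)" for s k
      using F(1) by (intro sum.subset_diff) auto
    hence "?\<rho> = (\<lambda>s k. (?\<eta> s k - (\<Sum>i\<in>?F. ?T i s k)) + (\<Sum>i\<in>?I. ?T i s k))"
      by (intro ext) (simp add: rho_slow_def sigma_slow_def)
    moreover have "\<forall>i\<in>?I. i \<in> indices \<and> vartheta i \<le> - real \<beta> / 3"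
      using F(2) by (auto simp: index_cut_def)
    moreover have "(\<lambda>s k. ?\<eta> s k - (\<Sum>i\<in>?F. ?T i s k)) \<in> symbol_class (- M) (2/3) (1/3) ?L"
      using F by (intro F0(3)[rule_format]) auto
    moreover have "finite ?I" using F(1) by simp
    ultimately show ?thesis
      by (intro exI[of _ "\<lambda>s k. ?\<eta> s k - (\<Sum>i\<in>?F. ?T i s k)"] exI[of _ ?I] conjI)
  qed
  have "?\<rho> \<in> symbol_class (- real \<beta> / 3) (2/3) (1/3) ?L"
  proof -
    obtain R I where R: "R \<in> symbol_class (- (real \<beta> / 3 + 1)) (2/3) (1/3) ?L" and
      I: "finite I" "\<And>i. i \<in> I \<Longrightarrow> i \<in> indices \<and> vartheta i \<le> - real \<beta> / 3" and
      \<rho>: "?\<rho> = (\<lambda>s k. R s k + (\<Sum>i\<in>I. ?T i s k))"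
      using decomposition[of "real \<beta> / 3 + 1"] by auto
    have "?T i \<in> symbol_class (- real \<beta> / 3) (2/3) (1/3) ?L" if "i \<in> I" for i
      using layer_sum_in_symbol_class[OF L Z layer c] I(2)[OF that] symbol_class_mono by blast
    moreover have "R \<in> symbol_class (- real \<beta> / 3) (2/3) (1/3) ?L"
      using R symbol_class_mono[of "- (real \<beta> / 3 + 1)" "- real \<beta> / 3"] by auto
    ultimately show ?thesis
      unfolding \<rho> using L I(1) by (intro symbol_class_add_sum)
  qed
  moreover have "\<exists>C>0. \<forall>s\<in>{0..?L}. \<forall>k\<ge>k0. norm ((D_s ?L ^^ n) ?\<rho> s k)
      \<le> C * k powr (- real \<beta> / 3) * W t1 t2 s k powi (- int n)" if "k0 > 1" for k0 n
  proof -
    let ?w = "\<lambda>s k. k powr (- real \<beta> / 3) / W t1 t2 s k ^ n"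
    \<comment> \<open>The loss \<open>k powr (n / 3)\<close> of \<open>n\<close> derivatives is built in; the additional \<open>1\<close> keeps \<open>M\<close> positive
       for \<open>\<beta> = n = 0\<close>.\<close>
    define M where "M = real \<beta> / 3 + real n / 3 + 1"
    have k0: "k0 > 0" using that by simp
    have W: "W t1 t2 s k > 0" if "k \<ge> k0" for s k using W_pos that k0 by simp
    have "M > 0" by (simp add: M_def add_nonneg_pos)
    then obtain R I where R: "R \<in> symbol_class (- M) (2/3) (1/3) ?L" and
      I: "finite I" "\<And>i. i \<in> I \<Longrightarrow> i \<in> indices \<and> vartheta i \<le> - real \<beta> / 3" and
      \<rho>: "?\<rho> = (\<lambda>s k. R s k + (\<Sum>i\<in>I. ?T i s k))"
      using decomposition by meson
    have "mixed_bounded ?L n 0 k0 ?w R"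
    proof -
      obtain B where B: "B > 0" "\<And>s k. s \<in> {0..?L} \<Longrightarrow> k \<ge> k0 \<Longrightarrow> W t1 t2 s k \<le> B"
        using W_bounded[OF k0] by blast
      let ?x = "- M + 1/3 * real n - 2/3 * real 0"
      have w: "k powr ?x \<le> k0 powr (?x + real \<beta> / 3) * B ^ n * ?w s k"
        if sk: "s \<in> {0..?L}" "k \<ge> k0" for s k
      proof -
        have "k powr ?x \<le> k0 powr (?x - (- real \<beta> / 3)) * k powr (- real \<beta> / 3)"
          using sk k0 by (intro powr_le_const_powr) (auto simp: M_def)
        also have "\<dots> = k0 powr (?x + real \<beta> / 3) * (W t1 t2 s k ^ n * ?w s k)"
          using W[OF sk(2), of s] by simp
        also have "\<dots> \<le> k0 powr (?x + real \<beta> / 3) * (B ^ n * ?w s k)"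
          using B(2)[OF sk] W[OF sk(2), of s]
          by (intro mult_left_mono mult_right_mono power_mono) auto
        finally show ?thesis by (simp only: mult.assoc)
      qed
      have "mixed_bounded ?L n 0 k0 (\<lambda>s k. k powr ?x) R"
        using R k0 unfolding symbol_class_iff by blast
      thus ?thesis
        by (rule mixed_bounded_mono[where B = "k0 powr (?x + real \<beta> / 3) * B ^ n"])
           (intro conjI w powr_ge_zero)
    qed
    moreover have "mixed_bounded ?L n 0 k0 ?w (?T i)" if i: "i \<in> I" for i
    proof (rule mixed_bounded_mono[OF layer_sum_mixed_bounded[OF L Z layer c(1) k0 c(2)]])
      show "i \<in> indices" using I(2) i by blast
      fix s k assume k: "k0 \<le> k"
      have "k powr (vartheta i - real 0)
          \<le> k0 powr (vartheta i + real \<beta> / 3) * k powr (- real \<beta> / 3)"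
        using powr_le_const_powr[of "vartheta i" "- real \<beta> / 3" k0 k] I(2)[OF i] k k0 by simp
      hence "k powr (vartheta i - real 0) / W t1 t2 s k ^ n
          \<le> k0 powr (vartheta i + real \<beta> / 3) * k powr (- real \<beta> / 3) / W t1 t2 s k ^ n"
        using W[OF k, of s] by (intro divide_right_mono) auto
      thus "0 \<le> k powr (vartheta i - real 0) / W t1 t2 s k ^ n \<and>
          k powr (vartheta i - real 0) / W t1 t2 s k ^ n
          \<le> k0 powr (vartheta i + real \<beta> / 3) * ?w s k"
        using W[OF k, of s] by simp
    qed
    ultimately have "mixed_bounded ?L n 0 k0 ?w ?\<rho>"
      unfolding \<rho> using L k0 I R strip_smooth_layer_sum[OF Z layer]
      by (intro mixed_bounded_add_sum) (auto simp: symbol_class_iff)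
    then obtain C where C: "\<And>s k. s \<in> {0..?L} \<Longrightarrow> k \<ge> k0 \<Longrightarrow> norm ((D_s ?L ^^ n) ?\<rho> s k) \<le> C * ?w s k"
      unfolding mixed_bounded_def funpow_0 by blast
    show ?thesis
    proof (intro exI[of _ "max C 1"] conjI ballI allI impI)
      fix s k assume sk: "s \<in> {0..?L}" "k0 \<le> k"
      have "norm ((D_s ?L ^^ n) ?\<rho> s k) \<le> C * ?w s k" using C sk by blast
      also have "\<dots> \<le> max C 1 * ?w s k"
        using W[OF sk(2), of s] by (intro mult_right_mono) auto
      also have "\<dots> = max C 1 * k powr (- real \<beta> / 3) * W t1 t2 s k powi (- int n)"
        by (simp only: power_int_minus power_int_of_nat divide_inverse mult.assoc)
      finally show "norm ((D_s ?L ^^ n) ?\<rho> s k)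
          \<le> max C 1 * k powr (- real \<beta> / 3) * W t1 t2 s k powi (- int n)" .
    qed simp
  qed
  ultimately show ?thesis by blast
qed

end
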